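(* Let $k>0$ and consider the two-dimensional rotational flow $U_t+U\cdot\nabla_x U=2kJU$, $x\in\mathbb{R}^2$. Then the solution with initial data $U(0,x)|_{x=\alpha}=U_0(\alpha)$ remains smooth for all time, $-\infty<t<\infty$, if and only if the initial data $U_0$ satisfy $$i_0(\alpha):=4k\,[k-\omega_0(\alpha)]-\Gamma_0(\alpha)>0\qquad\text{for all }\alpha\in\mathbb{R}^2 .$$ Moreover, as the smooth solution evolves along its particle path, the vorticity $\omega(t)=\omega(t,\alpha)$ and the eigenvalues $\lambda_j$ (and hence the divergence $d(t)=d(t,\alpha)$) form a periodic orbit in phase space, with a path-dependent period $\overline{T}=\overline{T}(\alpha)$ given by $$\overline{T}=\frac{2}{k}\int_{-\pi/2}^{\pi/2}\frac{d\theta}{(\theta_0^{-1}+\theta_0)+(\theta_0^{-1}-\theta_0)\sin\theta}.$$ Here $\theta_0=\theta_0(\alpha)<1$ is determined by the initial data through $$\theta_0=\frac{\sqrt{1+8kp_0}-1}{\sqrt{1+8kp_0}+1},\qquad p_0:=\frac{\sqrt{i_0}}{d_0^2+\bigl(\sqrt{i_0}-2k\bigr)^2},$$ with $i_0=i_0(\alpha)$ and $d_0=d_0(\alpha)$.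
   Context: $U=(u,v)^\top:\ (t,x)\mapsto U(t,x)\in\mathbb{R}^2$ is the velocity field, and $J=\begin{pmatrix}0&1\\ -1&0\end{pmatrix}$, so $JU=(v,-u)^\top$. Writing the two space coordinates as $(x,y)$, the velocity gradient is $\nabla_xU=\begin{pmatrix}u_x&u_y\\ v_x&v_y\end{pmatrix}$, with eigenvalues $\lambda_1,\lambda_2$ (possibly complex conjugate). The divergence is $d=u_x+v_y=\lambda_1+\lambda_2$; the vorticity $\omega=\nabla_x\times U$ is taken with the sign convention $\omega=u_y-v_x$; and $\Gamma=(\lambda_2-\lambda_1)^2=d^2-4\det(\nabla_xU)$ is the (real-valued) squared spectral gap. The subscript $0$ denotes values computed from the initial data: $\omega_0(\alpha),d_0(\alpha),\Gamma_0(\alpha)$ are $\omega,d,\Gamma$ for $U_0$ at $\alpha$. The particle path $X_\alpha(t)$ solves $\dot X_\alpha(t)=U(t,X_\alpha(t))$, $X_\alpha(0)=\alpha$, and $\omega(t,\alpha),\lambda_j(t,\alpha),d(t,\alpha)$ denote the values of $\omega,\lambda_j,d$ at $(t,X_\alpha(t))$.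
   Formalization: Global smoothness: a smooth solution on an open space-time set containing every particle path for all time (all of R×R² for sublinear U_0), as for general data particles may not fill the plane. If d_0=0 and √i_0=2k, p_0 is undefined and the orbit is a rest point. *)

theory Defs
  imports "HOL-Analysis.Analysis"
begin

text \<open>Functions of class C^n and C^infinity, meant for open sets \<open>S\<close>.\<close>

primrec ck_on :: "nat \<Rightarrow> ('a::euclidean_space \<Rightarrow> 'b::real_normed_vector) \<Rightarrow> 'a set \<Rightarrow> bool" where
  "ck_on 0 f S = continuous_on S f"
| "ck_on (Suc n) f S =
     (\<exists>f'. (\<forall>x\<in>S. (f has_derivative f' x) (at x)) \<and> (\<forall>v. ck_on n (\<lambda>x. f' x v) S))"

definition smooth_on :: "'a::euclidean_space set \<Rightarrow> ('a \<Rightarrow> 'b::real_normed_vector) \<Rightarrow> bool" where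
  "smooth_on S f \<longleftrightarrow> (\<forall>n. ck_on n f S)"

text \<open>Quantities attached to a velocity gradient \<open>A\<close>, where \<open>A $ i $ j\<close> is the derivative of the
  i-th velocity component in the j-th space direction.\<close>

definition vorticity :: "real^2^2 \<Rightarrow> real" where
  "vorticity A = A $ 1 $ 2 - A $ 2 $ 1"

definition divergence :: "real^2^2 \<Rightarrow> real" where
  "divergence A = trace A"

definition spectral_gap_sq :: "real^2^2 \<Rightarrow> real" where
  "spectral_gap_sq A = (divergence A)\<^sup>2 - 4 * det A"

definition eigenvalues :: "real^2^2 \<Rightarrow> complex set" where
  "eigenvalues A =
     {l. \<exists>v :: complex^2. v \<noteq> 0 \<and> map_matrix complex_of_real A *v v = l *s v}"

definition J :: "real^2^2" where
  "J = vector [vector [0, 1], vector [-1, 0]]"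

text \<open>A smooth solution is defined on an open set \<open>\<Omega>\<close> of space-time (time first) containing the
  initial plane. The classical notion is the case \<open>\<Omega> = UNIV\<close>; it is the right one if the data
  grow sublinearly. For unrestricted smooth data the particles present at time \<open>t\<close> need not fill the
  plane. For example, if \<open>U\<^sub>0\<close> is such that the particle starting at \<open>(x, y)\<close> is at
  \<open>(exp x, exp y)\<close> at time \<open>pi/(2*k)\<close>, then the threshold condition of the theorem holds everywhere,
  but at that time all particles are in the open first quadrant, and the initial data determine
  the velocity only there.\<close>

definition smooth_solution ::
    "real \<Rightarrow> (real^2 \<Rightarrow> real^2) \<Rightarrow> (real \<times> (real^2)) set \<Rightarrow> (real \<Rightarrow> real^2 \<Rightarrow> real^2) \<Rightarrow> bool" where
  "smooth_solution k U0 \<Omega> U \<longleftrightarrow>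
     open \<Omega> \<and> smooth_on \<Omega> (\<lambda>(t, x). U t x) \<and>
     (\<forall>\<alpha>. (0, \<alpha>) \<in> \<Omega> \<and> U 0 \<alpha> = U0 \<alpha>) \<and>
     (\<forall>(t, x)\<in>\<Omega>. vector_derivative (\<lambda>s. U s x) (at t) + jacobian (U t) (at x) *v U t x
                  = (2 * k) *\<^sub>R (J *v U t x))"

definition particle_path ::
    "(real \<times> (real^2)) set \<Rightarrow> (real \<Rightarrow> real^2 \<Rightarrow> real^2) \<Rightarrow> real^2 \<Rightarrow> (real \<Rightarrow> real^2) \<Rightarrow> bool" where
  "particle_path \<Omega> U \<alpha> X \<longleftrightarrow>
     X 0 = \<alpha> \<and> (\<forall>t. (t, X t) \<in> \<Omega> \<and> (X has_vector_derivative U t (X t)) (at t))"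

text \<open>The solution stays smooth for all times if every particle can be followed within \<open>\<Omega>\<close> for all
  times. For \<open>\<Omega> = UNIV\<close> this is automatic, see \<open>smooth_solution_UNIV_global\<close> below.\<close>

definition global_smooth_solution ::
    "real \<Rightarrow> (real^2 \<Rightarrow> real^2) \<Rightarrow> (real \<times> (real^2)) set \<Rightarrow> (real \<Rightarrow> real^2 \<Rightarrow> real^2) \<Rightarrow> bool" where
  "global_smooth_solution k U0 \<Omega> U \<longleftrightarrow>
     smooth_solution k U0 \<Omega> U \<and> (\<forall>\<alpha>. \<exists>X. particle_path \<Omega> U \<alpha> X)"

definition sublinear_growth :: "(real^2 \<Rightarrow> real^2) \<Rightarrow> bool" where
  "sublinear_growth U0 \<longleftrightarrow> ((\<lambda>x. norm (U0 x) / norm x) \<longlongrightarrow> 0) at_infinity"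

definition threshold :: "real \<Rightarrow> (real^2 \<Rightarrow> real^2) \<Rightarrow> real^2 \<Rightarrow> real" where
  "threshold k U0 \<alpha> =
     4 * k * (k - vorticity (jacobian U0 (at \<alpha>))) - spectral_gap_sq (jacobian U0 (at \<alpha>))"

text \<open>If \<open>p0_denom\<close> vanishes, \<open>p0\<close> is infinite and \<open>theta0\<close> has the limit value 1: this is the rest
  point of the phase-space dynamics (for instance \<open>U\<^sub>0 = 0\<close>), where the orbit is a single point.
  With division by zero the definitions below carry no information in this case.\<close>

definition p0_denom :: "real \<Rightarrow> (real^2 \<Rightarrow> real^2) \<Rightarrow> real^2 \<Rightarrow> real" where
  "p0_denom k U0 \<alpha> =
     (divergence (jacobian U0 (at \<alpha>)))\<^sup>2 + (sqrt (threshold k U0 \<alpha>) - 2 * k)\<^sup>2"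

definition p0 :: "real \<Rightarrow> (real^2 \<Rightarrow> real^2) \<Rightarrow> real^2 \<Rightarrow> real" where
  "p0 k U0 \<alpha> = sqrt (threshold k U0 \<alpha>) / p0_denom k U0 \<alpha>"

definition theta0 :: "real \<Rightarrow> (real^2 \<Rightarrow> real^2) \<Rightarrow> real^2 \<Rightarrow> real" where
  "theta0 k U0 \<alpha> =
     (sqrt (1 + 8 * k * p0 k U0 \<alpha>) - 1) / (sqrt (1 + 8 * k * p0 k U0 \<alpha>) + 1)"

definition path_period :: "real \<Rightarrow> (real^2 \<Rightarrow> real^2) \<Rightarrow> real^2 \<Rightarrow> real" where
  "path_period k U0 \<alpha> =
     2 / k * integral {- (pi / 2)..pi / 2}
       (\<lambda>\<theta>. 1 / ((inverse (theta0 k U0 \<alpha>) + theta0 k U0 \<alpha>)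
                 + (inverse (theta0 k U0 \<alpha>) - theta0 k U0 \<alpha>) * sin \<theta>))"

text \<open>The period of an orbit is its least positive period.\<close>

definition periodic_orbit :: "(real \<Rightarrow> 'a) \<Rightarrow> real \<Rightarrow> bool" where
  "periodic_orbit z T \<longleftrightarrow>
     T > 0 \<and> (\<forall>t. z (t + T) = z t) \<and> (\<forall>S. 0 < S \<and> S < T \<longrightarrow> (\<exists>t. z (t + S) \<noteq> z t))"

definition stationary_orbit :: "(real \<Rightarrow> 'a) \<Rightarrow> bool" where
  "stationary_orbit z \<longleftrightarrow> (\<forall>t. z t = z 0)"

lemma J_mult: "J *v x = vector [x $ 2, - x $ 1]"
  by (simp add: J_def matrix_vector_mult_def vec_eq_iff sum_2 forall_2)

lemma J_ortho: "x \<bullet> (J *v x) = 0"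
  by (simp add: J_mult inner_vec_def sum_2)

lemma gronwall_zero:
  fixes f f' c :: "real \<Rightarrow> real"
  assumes d: "\<And>t. (f has_real_derivative f' t) (at t)"
    and b: "\<And>t. \<bar>f' t\<bar> \<le> c t * f t" and c: "continuous_on UNIV c"
    and f0: "f 0 = 0" and pos: "\<And>t. f t \<ge> 0"
  shows "f t = 0"
proof -
  have "bounded (c ` cball 0 \<bar>t\<bar>)"
    by (intro compact_imp_bounded compact_continuous_image continuous_on_subset[OF c]) auto
  then obtain C where C: "\<And>s. \<bar>s\<bar> \<le> \<bar>t\<bar> \<Longrightarrow> \<bar>c s\<bar> \<le> C"
    by (force simp: bounded_iff)
  have bC: "\<bar>f' s\<bar> \<le> C * f s" if "\<bar>s\<bar> \<le> \<bar>t\<bar>" for s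
    using b[of s] C[OF that] mult_right_mono[OF _ pos[of s], of "c s" C] by linarith
  show ?thesis
  proof (cases "t \<ge> 0")
    case True
    have "f t * exp (- C * t) \<le> f 0 * exp (- C * 0)"
    proof (rule DERIV_nonpos_imp_nonincreasing[OF True])
      fix s assume s: "0 \<le> s" "s \<le> t"
      have "((\<lambda>s. f s * exp (- C * s)) has_real_derivative (f' s - C * f s) * exp (- C * s)) (at s)"
        by (auto intro!: derivative_eq_intros d simp: algebra_simps)
      moreover have "(f' s - C * f s) * exp (- C * s) \<le> 0"
        using bC[of s] s by (auto intro!: mult_nonpos_nonneg)
      ultimately show "\<exists>y. ((\<lambda>s. f s * exp (- C * s)) has_real_derivative y) (at s) \<and> y \<le> 0"
        by blast
    qed
    then have "f t \<le> 0" using f0 by (simp add: mult_le_0_iff)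
    with pos[of t] show ?thesis by linarith
  next
    case False
    then have "t \<le> 0" by simp
    then have "f t * exp (C * t) \<le> f 0 * exp (C * 0)"
    proof (rule DERIV_nonneg_imp_nondecreasing)
      fix s assume s: "t \<le> s" "s \<le> 0"
      have "((\<lambda>s. f s * exp (C * s)) has_real_derivative (f' s + C * f s) * exp (C * s)) (at s)"
        by (auto intro!: derivative_eq_intros d simp: algebra_simps)
      moreover have "(f' s + C * f s) * exp (C * s) \<ge> 0"
        using bC[of s] s by (auto intro!: mult_nonneg_nonneg)
      ultimately show "\<exists>y. ((\<lambda>s. f s * exp (C * s)) has_real_derivative y) (at s) \<and> 0 \<le> y"
        by blast
    qed
    then have "f t \<le> 0" using f0 by (simp add: mult_le_0_iff)
    with pos[of t] show ?thesis by linarith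
  qed
qed

lemma smooth_solution_UNIV_global:
  assumes k: "k > 0" and sol: "smooth_solution k U0 UNIV U"
  shows "global_smooth_solution k U0 UNIV U"
proof -
  let ?G = "\<lambda>(t, x). U t x"
  have "ck_on (Suc 0) ?G UNIV"
    using sol unfolding smooth_solution_def smooth_on_def by blast
  then obtain G' where G': "\<And>p. (?G has_derivative G' p) (at p)"
    and cG': "\<And>v. continuous_on UNIV (\<lambda>p. G' p v)" by auto
  have lin: "linear (G' p)" for p using G' has_derivative_linear by blast
  have pde: "G' (t, x) (1, U t x) = (2 * k) *\<^sub>R (J *v U t x)" for t x
  proof -
    have "((\<lambda>s. ?G (s, x)) has_derivative (\<lambda>h. G' (t, x) (h, 0))) (at t)"
      by (rule has_derivative_compose[OF _ G', of "\<lambda>s. (s, x)"]) (auto intro!: derivative_eq_intros)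
    then have "((\<lambda>s. U s x) has_derivative (\<lambda>h. h *\<^sub>R G' (t, x) (1, 0))) (at t)"
      by (simp add: linear_scale[OF lin, symmetric])
    then have 1: "vector_derivative (\<lambda>s. U s x) (at t) = G' (t, x) (1, 0)"
      by (simp add: has_vector_derivative_def[symmetric] vector_derivative_at)
    have "((\<lambda>y. ?G (t, y)) has_derivative (\<lambda>h. G' (t, x) (0, h))) (at x)"
      by (rule has_derivative_compose[OF _ G', of "\<lambda>s. (t, s)"]) (auto intro!: derivative_eq_intros)
    then have h: "(U t has_derivative (\<lambda>h. G' (t, x) (0, h))) (at x)" by simp
    then have "jacobian (U t) (at x) *v y = G' (t, x) (0, y)" for y
      using frechet_derivative_at[OF h] jacobian_works has_derivative_unique
      by (metis differentiable_def)
    moreover have "G' (t, x) (1, 0) + G' (t, x) (0, U t x) = G' (t, x) (1, U t x)"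
      by (simp add: linear_add[OF lin, symmetric])
    moreover have "vector_derivative (\<lambda>s. U s x) (at t) + jacobian (U t) (at x) *v U t x
        = (2 * k) *\<^sub>R (J *v U t x)"
      using sol unfolding smooth_solution_def by auto
    ultimately show ?thesis using 1 by simp
  qed
  have "\<exists>X. particle_path UNIV U \<alpha> X" for \<alpha>
  proof -
    define V where "V t = cos (2*k*t) *\<^sub>R U0 \<alpha> + sin (2*k*t) *\<^sub>R (J *v U0 \<alpha>)" for t
    define Y where
      "Y t = \<alpha> + (sin (2*k*t) / (2*k)) *\<^sub>R U0 \<alpha> + ((1 - cos (2*k*t)) / (2*k)) *\<^sub>R (J *v U0 \<alpha>)" for t
    have Y': "(Y has_vector_derivative V t) (at t)" for t
    proof -
      have 1: "((\<lambda>t. sin (2*k*t) / (2*k)) has_real_derivative cos (2*k*t)) (at t)"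
        using k by (auto intro!: derivative_eq_intros)
      have 2: "((\<lambda>t. (1 - cos (2*k*t)) / (2*k)) has_real_derivative sin (2*k*t)) (at t)"
        using k by (auto intro!: derivative_eq_intros)
      show ?thesis unfolding Y_def V_def
        by (rule has_vector_derivative_eq_rhs, rule has_vector_derivative_add,
            rule has_vector_derivative_add, rule has_vector_derivative_const,
            rule has_vector_derivative_scaleR[OF 1 has_vector_derivative_const],
            rule has_vector_derivative_scaleR[OF 2 has_vector_derivative_const]) simp
    qed
    have JJ: "J *v (J *v y) = - y" for y
      by (simp add: J_mult vec_eq_iff forall_2)
    have V': "(V has_vector_derivative (2*k) *\<^sub>R (J *v V t)) (at t)" for t
    proof -
      have 1: "((\<lambda>t. cos (2*k*t)) has_real_derivative - (2*k) * sin (2*k*t)) (at t)"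
        by (auto intro!: derivative_eq_intros)
      have 2: "((\<lambda>t. sin (2*k*t)) has_real_derivative (2*k) * cos (2*k*t)) (at t)"
        by (auto intro!: derivative_eq_intros)
      have 3: "J *v V t = cos (2*k*t) *\<^sub>R (J *v U0 \<alpha>) - sin (2*k*t) *\<^sub>R U0 \<alpha>"
        by (simp add: V_def matrix_vector_right_distrib matrix_vector_mult_scaleR JJ)
      show ?thesis unfolding 3 unfolding V_def
        by (rule has_vector_derivative_eq_rhs, rule has_vector_derivative_add,
            rule has_vector_derivative_scaleR[OF 1 has_vector_derivative_const],
            rule has_vector_derivative_scaleR[OF 2 has_vector_derivative_const])
          (simp add: scaleR_diff_right)
    qed
    define W where "W t = U t (Y t) - V t" for t
    have W': "(W has_vector_derivative (2*k) *\<^sub>R (J *v W t) - G' (t, Y t) (0, W t)) (at t)" for t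
    proof -
      have "((\<lambda>s. ?G (s, Y s)) has_derivative (\<lambda>h. G' (t, Y t) (h, h *\<^sub>R V t))) (at t)"
        by (rule has_derivative_compose[OF _ G', of "\<lambda>s. (s, Y s)"])
          (auto intro!: derivative_eq_intros Y'[unfolded has_vector_derivative_def])
      moreover have "G' (t, Y t) (h, h *\<^sub>R V t) = h *\<^sub>R G' (t, Y t) (1, V t)" for h
        by (simp add: linear_scale[OF lin, symmetric])
      ultimately have "((\<lambda>s. U s (Y s)) has_vector_derivative G' (t, Y t) (1, V t)) (at t)"
        by (simp add: has_vector_derivative_def)
      then have "(W has_vector_derivative G' (t, Y t) (1, V t) - (2*k) *\<^sub>R (J *v V t)) (at t)"
        unfolding W_def by (intro has_vector_derivative_diff V')
      moreover have "G' (t, Y t) (1, V t) = G' (t, Y t) (1, U t (Y t)) - G' (t, Y t) (0, W t)"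
        by (simp add: linear_diff[OF lin, symmetric] W_def)
      moreover have "J *v W t = J *v U t (Y t) - J *v V t"
        by (simp add: W_def matrix_vector_mult_diff_distrib)
      ultimately show ?thesis
        by (simp add: pde scaleR_diff_right diff_diff_eq add.commute)
    qed
    define g where "g i t = G' (t, Y t) (0, axis i 1)" for i :: 2 and t
    define c where "c t = 2 * (norm (g 1 t) + norm (g 2 t))" for t
    have cY: "continuous_on UNIV Y"
      using Y' has_vector_derivative_continuous continuous_at_imp_continuous_on by blast
    have "continuous_on UNIV (g i)" for i
      unfolding g_def
      by (rule continuous_on_compose2[OF cG', of _ "\<lambda>t. (t, Y t)"]) (auto intro!: continuous_intros cY)
    then have cc: "continuous_on UNIV c"
      unfolding c_def by (intro continuous_intros) auto
    have gb: "norm (G' (t, Y t) (0, w)) \<le> (norm (g 1 t) + norm (g 2 t)) * norm w" for t w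
    proof -
      have "w = w $ 1 *\<^sub>R axis 1 1 + w $ 2 *\<^sub>R axis 2 1"
        by (simp add: vec_eq_iff forall_2 axis_def)
      then have "(0::real, w) = w $ 1 *\<^sub>R (0, axis 1 1) + w $ 2 *\<^sub>R (0, axis 2 1)" by simp
      then have "G' (t, Y t) (0, w) = w $ 1 *\<^sub>R g 1 t + w $ 2 *\<^sub>R g 2 t"
        by (simp only: g_def linear_add[OF lin] linear_scale[OF lin])
      then have "norm (G' (t, Y t) (0, w)) \<le> \<bar>w $ 1\<bar> * norm (g 1 t) + \<bar>w $ 2\<bar> * norm (g 2 t)"
        by (metis norm_scaleR norm_triangle_ineq)
      also have "\<dots> \<le> norm w * norm (g 1 t) + norm w * norm (g 2 t)"
        by (intro add_mono mult_right_mono component_le_norm_cart) auto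
      finally show ?thesis by (simp add: algebra_simps)
    qed
    have "W t \<bullet> W t = 0" for t
    proof (rule gronwall_zero[where f = "\<lambda>t. W t \<bullet> W t" and c = c
          and f' = "\<lambda>t. - 2 * (W t \<bullet> G' (t, Y t) (0, W t))"])
      fix t
      show "((\<lambda>t. W t \<bullet> W t) has_real_derivative - 2 * (W t \<bullet> G' (t, Y t) (0, W t))) (at t)"
      proof -
        have "((\<lambda>t. W t \<bullet> W t) has_derivative
            (\<lambda>h. W t \<bullet> (h *\<^sub>R ((2*k) *\<^sub>R (J *v W t) - G' (t, Y t) (0, W t)))
               + (h *\<^sub>R ((2*k) *\<^sub>R (J *v W t) - G' (t, Y t) (0, W t))) \<bullet> W t)) (at t)"
          by (rule has_derivative_inner) (rule W'[unfolded has_vector_derivative_def])+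
        then show ?thesis
          unfolding has_field_derivative_def
          by (rule has_derivative_eq_rhs)
            (simp add: fun_eq_iff inner_diff_right J_ortho inner_commute[of _ "W t"])
      qed
      have "\<bar>W t \<bullet> G' (t, Y t) (0, W t)\<bar> \<le> norm (W t) * ((norm (g 1 t) + norm (g 2 t)) * norm (W t))"
        using Cauchy_Schwarz_ineq2 mult_left_mono[OF gb norm_ge_zero] order_trans by blast
      then show "\<bar>- 2 * (W t \<bullet> G' (t, Y t) (0, W t))\<bar> \<le> c t * (W t \<bullet> W t)"
        by (simp add: c_def power2_norm_eq_inner[symmetric] power2_eq_square abs_mult algebra_simps)
    next
      have "U 0 \<alpha> = U0 \<alpha>" using sol unfolding smooth_solution_def by auto
      then show "W 0 \<bullet> W 0 = 0" by (simp add: W_def V_def Y_def)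
    qed (auto intro: cc)
    then have "U t (Y t) = V t" for t by (simp add: W_def)
    then show ?thesis
      using Y' by (auto simp: particle_path_def Y_def intro!: exI[of _ Y])
  qed
  then show ?thesis using sol unfolding global_smooth_solution_def by blast
qed

end

theory Submission
  imports Defs
begin

text \<open>Along its path a particle satisfies \<open>X'' = 2 k J X'\<close>, so it moves on a circle, and a solution is the
  composition of an explicit velocity with the inverse of the flow map
  \<open>\<Phi>\<^sub>t = I + (s + c J) U\<^sub>0\<close>, where \<open>s = sin (2 k t) / (2 k)\<close> and \<open>c = (1 - cos (2 k t)) / (2 k)\<close>.
  The Jacobian determinant of \<open>\<Phi>\<^sub>t\<close> is \<open>1 + b + a sin (2 k t) - b cos (2 k t)\<close>; it is positive for
  all \<open>t\<close> iff \<open>1 + 2 b > a\<^sup>2\<close>, and this is the threshold condition. The condition also says that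
  \<open>D U\<^sub>0 - k J\<close> has no real eigenvalue, which makes \<open>\<Phi>\<^sub>t\<close> injective; for data of sublinear growth
  it is onto by Brouwer's theorem. The velocity gradient \<open>M\<close> on the path is determined by
  \<open>M (D \<Phi>\<^sub>t) = (D \<Phi>\<^sub>t)'\<close>; hence the orbit has period \<open>pi / k\<close>, which is also the value of the
  integral for \<open>T\<close>, and the divergence, being the logarithmic derivative of the determinant, has no
  shorter period unless \<open>a = b = 0\<close>.\<close>

section \<open>Calculus of smooth functions\<close>

declare ck_on.simps(2) [simp del]

lemma ck_on_SucI:
  assumes "\<And>x. x \<in> S \<Longrightarrow> (f has_derivative f' x) (at x)"
    and "\<And>v. ck_on n (\<lambda>x. f' x v) S"
  shows "ck_on (Suc n) f S"
  using assms by (auto simp: ck_on.simps(2))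

lemma ck_on_SucE:
  assumes "ck_on (Suc n) f S"
  obtains f' where "\<And>x. x \<in> S \<Longrightarrow> (f has_derivative f' x) (at x)"
    and "\<And>v. ck_on n (\<lambda>x. f' x v) S"
  using assms by (auto simp: ck_on.simps(2))

lemma ck_on_Suc_lower: "ck_on (Suc n) f S \<Longrightarrow> ck_on n f S"
proof (induction n arbitrary: f)
  case 0
  then show ?case
    by (elim ck_on_SucE) (auto intro!: continuous_at_imp_continuous_on has_derivative_continuous)
next
  case (Suc n)
  from Suc.prems show ?case
  proof (rule ck_on_SucE)
    fix f' assume "\<And>x. x \<in> S \<Longrightarrow> (f has_derivative f' x) (at x)"
      and "\<And>v. ck_on (Suc n) (\<lambda>x. f' x v) S"
    then show ?thesis using ck_on_SucI Suc.IH by metis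
  qed
qed

text \<open>A derivative at a point depends only on values near it, so on an open set the witness
  derivative of \<open>f\<close> also serves \<open>g\<close>.\<close>

lemma ck_on_cong:
  assumes "open S" "\<And>x. x \<in> S \<Longrightarrow> f x = g x" "ck_on n f S"
  shows "ck_on n g S"
proof (cases n)
  case 0
  then show ?thesis
    using assms by (simp cong: continuous_on_cong)
next
  case (Suc m)
  then obtain f' where f': "\<And>x. x \<in> S \<Longrightarrow> (f has_derivative f' x) (at x)"
    "\<And>v. ck_on m (\<lambda>x. f' x v) S"
    using assms(3) ck_on_SucE by blast
  then show ?thesis
    unfolding Suc using assms has_derivative_transform_within_open
    by (intro ck_on_SucI) blast+
qed

lemma ck_on_const: "ck_on n (\<lambda>x. c) S"
proof (induction n arbitrary: c)
  case (Suc n)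
  then show ?case by (intro ck_on_SucI[where f' = "\<lambda>x v. 0"]) auto
qed auto

lemma ck_on_linear: "bounded_linear f \<Longrightarrow> ck_on n f S"
  by (cases n)
    (auto intro!: ck_on_SucI[where f' = "\<lambda>x. f"] ck_on_const bounded_linear_imp_has_derivative
      linear_continuous_on)

lemma ck_on_add: "ck_on n f S \<Longrightarrow> ck_on n g S \<Longrightarrow> ck_on n (\<lambda>x. f x + g x) S"
proof (induction n arbitrary: f g)
  case (Suc n)
  from Suc.prems obtain f' g' where
    "\<And>x. x \<in> S \<Longrightarrow> (f has_derivative f' x) (at x)" "\<And>v. ck_on n (\<lambda>x. f' x v) S"
    "\<And>x. x \<in> S \<Longrightarrow> (g has_derivative g' x) (at x)" "\<And>v. ck_on n (\<lambda>x. g' x v) S"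
    by (elim ck_on_SucE) blast
  then show ?case
    by (intro ck_on_SucI[where f' = "\<lambda>x v. f' x v + g' x v"] Suc.IH has_derivative_add)
qed (auto intro: continuous_on_add)

lemma ck_on_sum:
  "(\<And>i. i \<in> I \<Longrightarrow> ck_on n (f i) S) \<Longrightarrow> ck_on n (\<lambda>x. \<Sum>i\<in>I. f i x) S"
  by (induction I rule: infinite_finite_induct) (auto intro: ck_on_const ck_on_add)

text \<open>Induction by the product rule: each term of the derivative keeps one undifferentiated
  factor, which \<open>ck_on_Suc_lower\<close> brings down to the level of the induction
  hypothesis.\<close>

lemma ck_on_bilinear:
  assumes "bounded_bilinear B"
  shows "ck_on n f S \<Longrightarrow> ck_on n g S \<Longrightarrow> ck_on n (\<lambda>x. B (f x) (g x)) S"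
proof (induction n arbitrary: f g)
  case 0
  then show ?case by (auto intro: bounded_bilinear.continuous_on[OF assms])
next
  case (Suc n)
  from Suc.prems obtain f' g' where
    "\<And>x. x \<in> S \<Longrightarrow> (f has_derivative f' x) (at x)" "\<And>v. ck_on n (\<lambda>x. f' x v) S"
    "\<And>x. x \<in> S \<Longrightarrow> (g has_derivative g' x) (at x)" "\<And>v. ck_on n (\<lambda>x. g' x v) S"
    by (elim ck_on_SucE) blast
  with Suc.prems[THEN ck_on_Suc_lower] show ?case
    by (intro ck_on_SucI[where f' = "\<lambda>x v. B (f x) (g' x v) + B (f' x v) (g x)"]
        ck_on_add Suc.IH bounded_bilinear.FDERIV[OF assms])
qed

lemmas ck_on_mult = ck_on_bilinear[OF bounded_bilinear_mult]
lemmas ck_on_scaleR = ck_on_bilinear[OF bounded_bilinear_scaleR]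
lemmas ck_on_inner = ck_on_bilinear[OF bounded_bilinear_inner]

lemma ck_on_compose_linear: "bounded_linear L \<Longrightarrow> ck_on n f S \<Longrightarrow> ck_on n (\<lambda>x. L (f x)) S"
proof (induction n arbitrary: f)
  case 0
  then show ?case by (auto intro: bounded_linear.continuous_on)
next
  case (Suc n)
  from Suc.prems(2) obtain f' where
    "\<And>x. x \<in> S \<Longrightarrow> (f has_derivative f' x) (at x)" "\<And>v. ck_on n (\<lambda>x. f' x v) S"
    by (elim ck_on_SucE) blast
  with Suc.prems(1) show ?case
    by (intro ck_on_SucI[where f' = "\<lambda>x v. L (f' x v)"] Suc.IH
        bounded_linear.has_derivative[OF Suc.prems(1)])
qed

lemma ck_on_minus: "ck_on n f S \<Longrightarrow> ck_on n (\<lambda>x. - f x) S"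
  by (rule ck_on_compose_linear[OF bounded_linear_minus[OF bounded_linear_ident]])

lemma ck_on_diff: "ck_on n f S \<Longrightarrow> ck_on n g S \<Longrightarrow> ck_on n (\<lambda>x. f x - g x) S"
  using ck_on_add[OF _ ck_on_minus, of n f S g] by simp

lemma ck_on_inverse:
  fixes f :: "'a::euclidean_space \<Rightarrow> real"
  assumes "\<And>x. x \<in> S \<Longrightarrow> f x \<noteq> 0"
  shows "ck_on n f S \<Longrightarrow> ck_on n (\<lambda>x. inverse (f x)) S"
proof (induction n)
  case 0
  then show ?case using assms by (auto intro: continuous_on_inverse)
next
  case (Suc n)
  from Suc.prems obtain f' where
    f': "\<And>x. x \<in> S \<Longrightarrow> (f has_derivative f' x) (at x)" "\<And>v. ck_on n (\<lambda>x. f' x v) S"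
    by (elim ck_on_SucE) blast
  with Suc.IH[OF ck_on_Suc_lower[OF Suc.prems]] assms show ?case
    by (intro ck_on_SucI[where f' = "\<lambda>x v. - (inverse (f x) * f' x v * inverse (f x))"]
        ck_on_minus ck_on_mult Deriv.has_derivative_inverse)
qed

text \<open>Proved jointly because each derivative involves the other function.\<close>

lemma ck_on_sin_cos:
  fixes f :: "'a::euclidean_space \<Rightarrow> real"
  shows "ck_on n f S \<Longrightarrow> ck_on n (\<lambda>x. sin (f x)) S \<and> ck_on n (\<lambda>x. cos (f x)) S"
proof (induction n)
  case 0
  then show ?case by (auto intro: continuous_on_sin continuous_on_cos)
next
  case (Suc n)
  from Suc.prems obtain f' where
    f': "\<And>x. x \<in> S \<Longrightarrow> (f has_derivative f' x) (at x)" "\<And>v. ck_on n (\<lambda>x. f' x v) S"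
    by (elim ck_on_SucE) blast
  note IH = Suc.IH[OF ck_on_Suc_lower[OF Suc.prems]]
  have "ck_on (Suc n) (\<lambda>x. sin (f x)) S"
    using IH f' by (intro ck_on_SucI[where f' = "\<lambda>x v. f' x v * cos (f x)"] ck_on_mult
        has_derivative_sin) auto
  moreover have "ck_on (Suc n) (\<lambda>x. cos (f x)) S"
    using IH f' by (intro ck_on_SucI[where f' = "\<lambda>x v. f' x v * - sin (f x)"] ck_on_mult
        ck_on_minus has_derivative_cos) auto
  ultimately show ?case ..
qed

text \<open>\<open>ck_on\<close> controls a derivative only in each fixed direction, while the chain
  rule needs directions that vary with the point. Expanding the direction in the finite basis
  reduces the second case to the first.\<close>

lemma ck_on_linear_family:
  fixes z :: "'a::euclidean_space \<Rightarrow> 'b::euclidean_space"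
  assumes "open S" "\<And>x. x \<in> S \<Longrightarrow> linear (L x)"
    and "\<And>v. ck_on n (\<lambda>x. L x v) S" "ck_on n z S"
  shows "ck_on n (\<lambda>x. L x (z x)) S"
proof (rule ck_on_cong[OF assms(1)])
  fix x assume x: "x \<in> S"
  have "L x (z x) = L x (\<Sum>b\<in>Basis. (z x \<bullet> b) *\<^sub>R b)"
    by (simp add: euclidean_representation)
  also have "\<dots> = (\<Sum>b\<in>Basis. (z x \<bullet> b) *\<^sub>R L x b)"
    by (simp add: linear_sum[OF assms(2)[OF x]] linear_scale[OF assms(2)[OF x]])
  finally show "(\<Sum>b\<in>Basis. (z x \<bullet> b) *\<^sub>R L x b) = L x (z x)" ..
qed (intro ck_on_sum ck_on_scaleR ck_on_inner assms ck_on_const)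

lemma ck_on_compose:
  fixes f :: "'a::euclidean_space \<Rightarrow> 'b::euclidean_space"
    and g :: "'b \<Rightarrow> 'c::real_normed_vector"
  assumes "open S" "f ` S \<subseteq> T"
  shows "ck_on n f S \<Longrightarrow> ck_on n g T \<Longrightarrow> ck_on n (\<lambda>x. g (f x)) S"
proof (induction n arbitrary: g)
  case 0
  then show ?case using assms by (auto intro: continuous_on_compose2)
next
  case (Suc n)
  from Suc.prems(1) show ?case
  proof (rule ck_on_SucE)
    fix f' assume f': "\<And>x. x \<in> S \<Longrightarrow> (f has_derivative f' x) (at x)"
      "\<And>v. ck_on n (\<lambda>x. f' x v) S"
    from Suc.prems(2) show ?thesis
    proof (rule ck_on_SucE)
      fix g' assume g': "\<And>x. x \<in> T \<Longrightarrow> (g has_derivative g' x) (at x)"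
        "\<And>v. ck_on n (\<lambda>x. g' x v) T"
      show ?thesis
      proof (rule ck_on_SucI[where f' = "\<lambda>x v. g' (f x) (f' x v)"])
        fix x assume x: "x \<in> S"
        then have "f x \<in> T" using assms by auto
        then show "((\<lambda>x. g (f x)) has_derivative (\<lambda>v. g' (f x) (f' x v))) (at x)"
          by (rule has_derivative_compose[OF f'(1)[OF x] g'(1)])
      next
        show "ck_on n (\<lambda>x. g' (f x) (f' x v)) S" for v
        proof (rule ck_on_linear_family[OF assms(1)])
          fix x assume "x \<in> S"
          then have "f x \<in> T" using assms by auto
          then show "linear (g' (f x))" by (rule has_derivative_linear[OF g'(1)])
        next
          show "ck_on n (\<lambda>x. g' (f x) v) S" for v
            by (rule Suc.IH[OF ck_on_Suc_lower[OF Suc.prems(1)] g'(2)])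
        qed (rule f')
      qed
    qed
  qed
qed

lemma ck_on_Pair:
  assumes "ck_on n f S" "ck_on n g S"
  shows "ck_on n (\<lambda>x. (f x, g x)) S"
  using ck_on_add[OF
      ck_on_compose_linear[OF bounded_linear_Pair[OF bounded_linear_ident bounded_linear_zero] assms(1)]
      ck_on_compose_linear[OF bounded_linear_Pair[OF bounded_linear_zero bounded_linear_ident] assms(2)]]
  by simp

lemmas ck_on_intros = ck_on_const ck_on_add ck_on_diff ck_on_minus ck_on_mult ck_on_scaleR
  ck_on_Pair

lemma smooth_on_differentiable:
  assumes "smooth_on S f" "x \<in> S"
  shows "f differentiable (at x)"
proof -
  have "ck_on (Suc 0) f S" using assms(1) by (simp add: smooth_on_def)
  then show ?thesis using assms(2) by (auto simp: differentiable_def ck_on.simps(2)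
        simp del: ck_on.simps(1))
qed

section \<open>The particle flow\<close>

text \<open>\<open>flow_sin\<close> and \<open>flow_cos\<close> are the antiderivatives of cos (2 k
  t) and sin (2 k t) that vanish at time 0, so that \<open>flow\<close> is the integral of
  \<open>flow_velocity\<close>.\<close>

definition flow_sin :: "real \<Rightarrow> real \<Rightarrow> real" where
  "flow_sin k t = sin (2 * k * t) / (2 * k)"

definition flow_cos :: "real \<Rightarrow> real \<Rightarrow> real" where
  "flow_cos k t = (1 - cos (2 * k * t)) / (2 * k)"

definition flow :: "real \<Rightarrow> (real^2 \<Rightarrow> real^2) \<Rightarrow> real \<Rightarrow> real^2 \<Rightarrow> real^2" where
  "flow k U0 t \<alpha> = \<alpha> + flow_sin k t *\<^sub>R U0 \<alpha> + flow_cos k t *\<^sub>R (J *v U0 \<alpha>)"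

definition flow_velocity :: "real \<Rightarrow> (real^2 \<Rightarrow> real^2) \<Rightarrow> real \<Rightarrow> real^2 \<Rightarrow> real^2" where
  "flow_velocity k U0 t \<alpha> = cos (2 * k * t) *\<^sub>R U0 \<alpha> + sin (2 * k * t) *\<^sub>R (J *v U0 \<alpha>)"

definition flow_gradient :: "real \<Rightarrow> real^2^2 \<Rightarrow> real \<Rightarrow> real^2 \<Rightarrow> real^2" where
  "flow_gradient k A t y = y + flow_sin k t *\<^sub>R (A *v y) + flow_cos k t *\<^sub>R (J *v (A *v y))"

text \<open>This is det (I + (s + c J) A) for k \<noteq> 0: the trace of J A is minus the vorticity,
  and the coefficient s^2 + c^2 of \<open>det A\<close> is written
  \<open>flow_cos k t / k\<close>.\<close>

definition flow_det :: "real \<Rightarrow> real^2^2 \<Rightarrow> real \<Rightarrow> real" where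
  "flow_det k A t =
     1 + flow_sin k t * divergence A - flow_cos k t * vorticity A + flow_cos k t / k * det A"

text \<open>The point (s, c) runs on the circle through the origin with centre (0, 1 / (2
  k)).\<close>

lemma flow_circle: "k \<noteq> 0 \<Longrightarrow> k * ((flow_sin k t)\<^sup>2 + (flow_cos k t)\<^sup>2) = flow_cos k t"
  using sin_cos_squared_add[of "2 * k * t"]
  by (simp add: flow_sin_def flow_cos_def field_simps power2_eq_square)

lemma cos_flow: "k \<noteq> 0 \<Longrightarrow> cos (2 * k * t) = 1 - 2 * k * flow_cos k t"
  by (simp add: flow_cos_def)

lemma sin_flow: "k \<noteq> 0 \<Longrightarrow> sin (2 * k * t) = 2 * k * flow_sin k t"
  by (simp add: flow_sin_def)

lemma J_J: "J *v (J *v y) = - y"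
  by (simp add: J_mult vec_eq_iff forall_2)

lemma flow_0: "flow k U0 0 \<alpha> = \<alpha>"
  by (simp add: flow_def flow_sin_def flow_cos_def)

lemma flow_velocity_0: "flow_velocity k U0 0 \<alpha> = U0 \<alpha>"
  by (simp add: flow_velocity_def)

lemma flow_sin_deriv:
  "k \<noteq> 0 \<Longrightarrow> (flow_sin k has_real_derivative cos (2 * k * t)) (at t within S)"
  unfolding flow_sin_def by (auto intro!: derivative_eq_intros)

lemma flow_cos_deriv:
  "k \<noteq> 0 \<Longrightarrow> (flow_cos k has_real_derivative sin (2 * k * t)) (at t within S)"
  unfolding flow_cos_def by (auto intro!: derivative_eq_intros)

lemma flow_time_derivative:
  assumes "k \<noteq> 0"
  shows "((\<lambda>t. flow k U0 t \<alpha>) has_vector_derivative flow_velocity k U0 t \<alpha>) (at t)"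
  unfolding flow_def flow_velocity_def
  using flow_sin_deriv[OF assms, of t UNIV] flow_cos_deriv[OF assms, of t UNIV]
  by (auto intro!: derivative_eq_intros)

lemma flow_velocity_time_derivative:
  "((\<lambda>t. flow_velocity k U0 t \<alpha>) has_vector_derivative
      (2 * k) *\<^sub>R (J *v flow_velocity k U0 t \<alpha>)) (at t)"
proof -
  have 1: "((\<lambda>t. cos (2*k*t)) has_real_derivative - (2*k) * sin (2*k*t)) (at t)"
    and 2: "((\<lambda>t. sin (2*k*t)) has_real_derivative (2*k) * cos (2*k*t)) (at t)"
    by (auto intro!: derivative_eq_intros)
  have 3: "J *v flow_velocity k U0 t \<alpha>
      = cos (2*k*t) *\<^sub>R (J *v U0 \<alpha>) - sin (2*k*t) *\<^sub>R U0 \<alpha>"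
    by (simp add: flow_velocity_def matrix_vector_right_distrib matrix_vector_mult_scaleR J_J)
  show ?thesis unfolding 3 unfolding flow_velocity_def
    using 1 2 by (auto intro!: derivative_eq_intros simp: scaleR_diff_right mult_ac)
qed

lemma flow_space_derivative:
  assumes "(U0 has_derivative (*v) A) (at \<alpha>)"
  shows "(flow k U0 t has_derivative flow_gradient k A t) (at \<alpha>)"
  unfolding flow_def flow_gradient_def
  by (intro derivative_intros assms bounded_linear.has_derivative[OF matrix_vector_mul_bounded_linear])

lemma flow_velocity_space_derivative:
  assumes "(U0 has_derivative (*v) A) (at \<alpha>)"
  shows "(flow_velocity k U0 t has_derivative
     (\<lambda>y. cos (2 * k * t) *\<^sub>R (A *v y) + sin (2 * k * t) *\<^sub>R (J *v (A *v y)))) (at \<alpha>)"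
  unfolding flow_velocity_def
  by (intro derivative_intros assms bounded_linear.has_derivative[OF matrix_vector_mul_bounded_linear])

text \<open>Cayley-Hamilton for the 2x2 matrix F of the flow gradient: F (tr F - F) = det F. This
  makes its inverse explicit.\<close>

lemma flow_gradient_adjugate:
  assumes "k \<noteq> 0"
  shows "flow_gradient k A t ((2 + flow_sin k t * divergence A - flow_cos k t * vorticity A) *\<^sub>R y
      - flow_gradient k A t y) = flow_det k A t *\<^sub>R y"
proof -
  define s c where "s = flow_sin k t" and "c = flow_cos k t"
  have ck: "c / k = s\<^sup>2 + c\<^sup>2"
    using flow_circle[OF assms, of t] assms by (simp add: s_def c_def field_simps)
  show ?thesis
    unfolding flow_gradient_def flow_det_def s_def[symmetric] c_def[symmetric] ck
    by (simp only: J_mult, simp add: vec_eq_iff forall_2 matrix_vector_mult_def sum_2 divergence_def trace_def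
        vorticity_def det_2 power2_eq_square algebra_simps)
qed

text \<open>The left inverse of \<open>I + (s + c J) A\<close> comes from \<open>A = (C + S J)\<^sup>-\<^sup>1 M F\<close> and
  \<open>(s + c J) (C + S J)\<^sup>-\<^sup>1 = s - c J\<close>, where \<open>C\<close> and \<open>S\<close> are cosine and sine of \<open>2 k t\<close>.\<close>

lemma transported_gradient:
  fixes A M :: "real^2^2"
  assumes k: "k \<noteq> 0"
    and MF: "\<And>y. M *v flow_gradient k A t y
      = cos (2 * k * t) *\<^sub>R (A *v y) + sin (2 * k * t) *\<^sub>R (J *v (A *v y))"
  shows "flow_det k A t \<noteq> 0"
    and "divergence M * flow_det k A t = cos (2 * k * t) * divergence A
      - sin (2 * k * t) * vorticity A + sin (2 * k * t) / k * det A"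
    and "det M * flow_det k A t = det A"
    and "vorticity M * flow_det k A t = cos (2 * k * t) * vorticity A
      + sin (2 * k * t) * divergence A + 2 * flow_cos k t * det A"
proof -
  define s c where "s = flow_sin k t" and "c = flow_cos k t"
  have C: "cos (2 * k * t) = 1 - 2 * k * c" and S: "sin (2 * k * t) = 2 * k * s"
    using cos_flow[OF k] sin_flow[OF k] by (auto simp: s_def c_def)
  have circ: "k * (s\<^sup>2 + c\<^sup>2) = c"
    using flow_circle[OF k, of t] by (simp add: s_def c_def)
  then have ck: "c / k = s\<^sup>2 + c\<^sup>2"
    using k by (simp add: field_simps)
  \<comment> \<open>F is the flow gradient as a matrix and G the gradient of the flow velocity.
    Cosine and sine are written as polynomials in s and c, so that \<open>circ\<close> carries the
    trigonometry.\<close>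
  define F where "F = mat 1 + s *\<^sub>R A + c *\<^sub>R (J ** A)"
  define G where "G = (1 - 2 * k * c) *\<^sub>R A + (2 * k * s) *\<^sub>R (J ** A)"
  define N :: "real^2^2" where "N = mat 1 - s *\<^sub>R M + c *\<^sub>R (J ** M)"
  have F: "F *v y = flow_gradient k A t y" for y
    by (simp add: F_def flow_gradient_def s_def c_def matrix_vector_mult_add_rdistrib
        scaleR_matrix_vector_assoc[symmetric] matrix_vector_mul_assoc)
  have G: "G *v y = cos (2 * k * t) *\<^sub>R (A *v y) + sin (2 * k * t) *\<^sub>R (J *v (A *v y))" for y
    by (simp add: G_def C S matrix_vector_mult_add_rdistrib
        scaleR_matrix_vector_assoc[symmetric] matrix_vector_mul_assoc)
  have "M ** F = G"
    using MF by (subst matrix_eq) (simp add: F G matrix_vector_mul_assoc[symmetric])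
  then have MFG: "(M ** F) $ i $ j = G $ i $ j" for i j by simp
  have detF: "det F = flow_det k A t"
    unfolding flow_det_def s_def[symmetric] c_def[symmetric] ck F_def
    by (simp add: det_2 J_def matrix_matrix_mult_def sum_2 mat_def divergence_def trace_def
        vorticity_def power2_eq_square algebra_simps)
  have e: "M$1$1 * F$1$1 + M$1$2 * F$2$1 = G$1$1" "M$1$1 * F$1$2 + M$1$2 * F$2$2 = G$1$2"
    "M$2$1 * F$1$1 + M$2$2 * F$2$1 = G$2$1" "M$2$1 * F$1$2 + M$2$2 * F$2$2 = G$2$2"
    using MFG by (simp_all add: matrix_matrix_mult_def sum_2)
  \<comment> \<open>Cramer's rule: M F = G is multiplied by the adjugate of F.\<close>
  have M: "M$1$1 * det F = G$1$1 * F$2$2 - G$1$2 * F$2$1"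
    "M$1$2 * det F = G$1$2 * F$1$1 - G$1$1 * F$1$2"
    "M$2$1 * det F = G$2$1 * F$2$2 - G$2$2 * F$2$1"
    "M$2$2 * det F = G$2$2 * F$1$1 - G$2$1 * F$1$2"
    by (simp_all add: e[symmetric] det_2 algebra_simps)
  have FG: "F$1$1 = 1 + s * A$1$1 + c * A$2$1" "F$1$2 = s * A$1$2 + c * A$2$2"
    "F$2$1 = s * A$2$1 - c * A$1$1" "F$2$2 = 1 + s * A$2$2 - c * A$1$2"
    "G$1$1 = (1 - 2 * k * c) * A$1$1 + 2 * k * s * A$2$1" "G$1$2 = (1 - 2 * k * c) * A$1$2 + 2 * k * s * A$2$2"
    "G$2$1 = (1 - 2 * k * c) * A$2$1 - 2 * k * s * A$1$1" "G$2$2 = (1 - 2 * k * c) * A$2$2 - 2 * k * s * A$1$2"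
    by (simp_all add: F_def G_def J_def matrix_matrix_mult_def sum_2 mat_def)
  have "N ** F = mat 1"
  proof -
    \<comment> \<open>Component form of (s - c J) (C + S J) = s + c J.\<close>
    have alg: "s * a + c * b
        = s * ((1 - 2 * k * c) * a + 2 * k * s * b) - c * ((1 - 2 * k * c) * b - 2 * k * s * a)"
      for a b
    proof -
      have "s * ((1 - 2 * k * c) * a + 2 * k * s * b) - c * ((1 - 2 * k * c) * b - 2 * k * s * a)
          = s * a + (2 * (k * (s\<^sup>2 + c\<^sup>2)) - c) * b"
        by (simp add: algebra_simps power2_eq_square)
      then show ?thesis unfolding circ by simp
    qed
    have "N *v (F *v y) = y" for y
    proof -
      have "N *v (F *v y) = F *v y - s *\<^sub>R (M *v (F *v y)) + c *\<^sub>R (J *v (M *v (F *v y)))"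
        by (simp add: N_def matrix_vector_mult_add_rdistrib matrix_vector_mult_diff_rdistrib
            scaleR_matrix_vector_assoc[symmetric] matrix_vector_mul_assoc[symmetric])
      also have "\<dots> = y"
        unfolding F MF unfolding flow_gradient_def C S s_def[symmetric] c_def[symmetric]
        using alg[of "(A *v y) $ 1" "(A *v y) $ 2"] alg[of "(A *v y) $ 2" "- (A *v y) $ 1"]
        by (simp add: vec_eq_iff forall_2 J_mult algebra_simps)
      finally show ?thesis .
    qed
    then show ?thesis by (subst matrix_eq) (simp add: matrix_vector_mul_assoc[symmetric])
  qed
  then have "det N * det F = 1" by (metis det_I det_mul)
  then show "flow_det k A t \<noteq> 0" using detF by auto
  have "divergence M * det F
      = (1 - 2 * k * c) * divergence A - 2 * k * s * vorticity A + 2 * s * det A"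
    unfolding divergence_def trace_def vorticity_def sum_2 det_2[of A] distrib_right M
    unfolding FG by (simp add: algebra_simps)
  then show "divergence M * flow_det k A t = cos (2 * k * t) * divergence A
      - sin (2 * k * t) * vorticity A + sin (2 * k * t) / k * det A"
    using k by (simp add: detF C S)
  \<comment> \<open>The factor is the determinant C^2 + S^2 of the rotation C + S J, and
    \<open>circ\<close> turns it into 1.\<close>
  have "det G = (1 - 4 * k * c + 4 * k * (k * (s\<^sup>2 + c\<^sup>2))) * det A"
    unfolding det_2 FG by (simp add: algebra_simps power2_eq_square)
  then have "det G = det A"
    unfolding circ by simp
  then show "det M * flow_det k A t = det A"
    using \<open>M ** F = G\<close> by (metis det_mul detF)
  have "vorticity M * det F = (1 - 2 * k * c) * vorticity A + 2 * k * s * divergence A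
      + 2 * (2 * (k * (s\<^sup>2 + c\<^sup>2)) - c) * det A"
    unfolding divergence_def trace_def vorticity_def sum_2 det_2[of A] left_diff_distrib M
    unfolding FG by (simp add: algebra_simps power2_eq_square)
  then show "vorticity M * flow_det k A t = cos (2 * k * t) * vorticity A
      + sin (2 * k * t) * divergence A + 2 * flow_cos k t * det A"
    unfolding circ by (simp add: detF C S c_def)
qed

section \<open>Smooth solutions along particle paths\<close>

lemma jacobian_mult:
  fixes f :: "real^'a \<Rightarrow> real^'b"
  assumes "(f has_derivative f') (at x)"
  shows "jacobian f (at x) *v y = f' y"
  using assms frechet_derivative_at[OF assms] has_derivative_linear[OF assms]
  by (simp add: jacobian_def matrix_works)

lemma has_derivative_jacobian:
  fixes f :: "real^'a \<Rightarrow> real^'b"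
  assumes "smooth_on S f" "x \<in> S"
  shows "(f has_derivative (*v) (jacobian f (at x))) (at x)"
  using smooth_on_differentiable[OF assms] jacobian_works by blast

text \<open>Collects the time and space derivatives of the equation into a single derivative of the
  space-time map in the direction (1, U) of a particle path.\<close>

lemma material_derivative:
  fixes U :: "real \<Rightarrow> real^2 \<Rightarrow> real^2"
  assumes G': "((\<lambda>(t, x). U t x) has_derivative G') (at (t, x))"
  shows "(U t has_derivative (\<lambda>y. G' (0, y))) (at x)"
    and "vector_derivative (\<lambda>s. U s x) (at t) + jacobian (U t) (at x) *v U t x = G' (1, U t x)"
proof -
  have lin: "linear G'" using G' has_derivative_linear by blast
  have "((\<lambda>s. (\<lambda>(t, x). U t x) (s, x)) has_derivative (\<lambda>h. G' (h, 0))) (at t)"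
    by (rule has_derivative_compose[of "\<lambda>s. (s, x)" "\<lambda>h. (h, 0)", OF _ G'])
      (auto intro!: derivative_eq_intros)
  then have "((\<lambda>s. U s x) has_derivative (\<lambda>h. h *\<^sub>R G' (1, 0))) (at t)"
    by (simp add: linear_scale[OF lin, symmetric])
  then have 1: "vector_derivative (\<lambda>s. U s x) (at t) = G' (1, 0)"
    by (simp add: has_vector_derivative_def[symmetric] vector_derivative_at)
  have "((\<lambda>y. (\<lambda>(t, x). U t x) (t, y)) has_derivative (\<lambda>h. G' (0, h))) (at x)"
    by (rule has_derivative_compose[of "\<lambda>y. (t, y)" "\<lambda>h. (0, h)", OF _ G'])
      (auto intro!: derivative_eq_intros)
  then show 2: "(U t has_derivative (\<lambda>h. G' (0, h))) (at x)" by simp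
  show "vector_derivative (\<lambda>s. U s x) (at t) + jacobian (U t) (at x) *v U t x = G' (1, U t x)"
    by (simp add: 1 jacobian_mult[OF 2] linear_add[OF lin, symmetric])
qed

lemma has_vector_derivative_along_path:
  fixes U :: "real \<Rightarrow> 'a::real_normed_vector \<Rightarrow> 'b::real_normed_vector"
  assumes G': "((\<lambda>(t, x). U t x) has_derivative G') (at (t, X t))"
    and X: "(X has_vector_derivative v) (at t)"
  shows "((\<lambda>s. U s (X s)) has_vector_derivative G' (1, v)) (at t)"
proof -
  have lin: "linear G'" using G' has_derivative_linear by blast
  have "((\<lambda>s. (\<lambda>(t, x). U t x) (s, X s)) has_derivative (\<lambda>h. G' (h, h *\<^sub>R v))) (at t)"
    by (rule has_derivative_compose[of "\<lambda>s. (s, X s)" "\<lambda>h. (h, h *\<^sub>R v)", OF _ G'])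
      (auto intro!: derivative_eq_intros X[unfolded has_vector_derivative_def])
  moreover have "G' (h, h *\<^sub>R v) = h *\<^sub>R G' (1, v)" for h
    by (simp add: linear_scale[OF lin, symmetric])
  ultimately show ?thesis by (simp add: has_vector_derivative_def)
qed

text \<open>W is orthogonal to its derivative, a multiple of J W, so its length is constant.\<close>

lemma rotation_ode_unique:
  assumes "\<And>t. (W has_vector_derivative c *\<^sub>R (J *v W t)) (at t)" "W 0 = 0"
  shows "W t = 0"
proof -
  have "((\<lambda>t. W t \<bullet> W t) has_real_derivative 0) (at t)" for t
  proof -
    have "((\<lambda>t. W t \<bullet> W t) has_derivative
        (\<lambda>h. W t \<bullet> (h *\<^sub>R c *\<^sub>R (J *v W t)) + (h *\<^sub>R c *\<^sub>R (J *v W t)) \<bullet> W t)) (at t)"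
      by (rule has_derivative_inner) (rule assms(1)[unfolded has_vector_derivative_def])+
    then show ?thesis
      unfolding has_field_derivative_def
      by (rule has_derivative_eq_rhs) (simp add: fun_eq_iff J_ortho inner_commute[of _ "W t"])
  qed
  then have "W t \<bullet> W t = W 0 \<bullet> W 0" by (intro DERIV_isconst_all allI)
  with assms(2) show ?thesis by simp
qed

text \<open>The velocity along the path and \<open>flow_velocity\<close> solve the same linear
  rotation equation with the same initial value. Path and flow then have equal velocities and the
  same starting point.\<close>

lemma particle_path_eq_flow:
  assumes k: "k \<noteq> 0" and sol: "smooth_solution k U0 \<Omega> U" and X: "particle_path \<Omega> U \<alpha> X"
  shows "X t = flow k U0 t \<alpha>" "U t (X t) = flow_velocity k U0 t \<alpha>"
proof -
  have X0: "X 0 = \<alpha>" and Om: "\<And>t. (t, X t) \<in> \<Omega>"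
    and X': "\<And>t. (X has_vector_derivative U t (X t)) (at t)"
    using X by (auto simp: particle_path_def)
  have "((\<lambda>s. U s (X s)) has_vector_derivative (2 * k) *\<^sub>R (J *v U t (X t))) (at t)" for t
  proof -
    obtain G' where G': "((\<lambda>(t, x). U t x) has_derivative G') (at (t, X t))"
      using sol Om smooth_on_differentiable unfolding smooth_solution_def differentiable_def by metis
    have "G' (1, U t (X t)) = (2 * k) *\<^sub>R (J *v U t (X t))"
      using sol Om[of t] unfolding smooth_solution_def material_derivative(2)[OF G', symmetric]
      by auto
    then show ?thesis using has_vector_derivative_along_path[OF G' X'] by simp
  qed
  then have "((\<lambda>t. U t (X t) - flow_velocity k U0 t \<alpha>) has_vector_derivative
      (2 * k) *\<^sub>R (J *v (U t (X t) - flow_velocity k U0 t \<alpha>))) (at t)" for t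
    using has_vector_derivative_diff[OF _ flow_velocity_time_derivative]
    by (simp add: matrix_vector_mult_diff_distrib scaleR_diff_right)
  moreover have "U 0 (X 0) - flow_velocity k U0 0 \<alpha> = 0"
    using sol by (simp add: X0 flow_velocity_0 smooth_solution_def)
  ultimately have vel: "U t (X t) - flow_velocity k U0 t \<alpha> = 0" for t
    by (rule rotation_ode_unique)
  then show "U t (X t) = flow_velocity k U0 t \<alpha>" by simp
  have "((\<lambda>t. X t - flow k U0 t \<alpha>) has_vector_derivative 0) (at t)" for t
    using has_vector_derivative_diff[OF X'[of t] flow_time_derivative[OF k, of U0 \<alpha>]] vel by simp
  then obtain c where "\<And>t. X t - flow k U0 t \<alpha> = c"
    using has_vector_derivative_zero_constant[OF convex_UNIV, of "\<lambda>t. X t - flow k U0 t \<alpha>"]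
    by auto
  from this[of t] this[of 0] show "X t = flow k U0 t \<alpha>"
    by (simp add: X0 flow_0)
qed

text \<open>Differentiates \<open>U t (flow k U0 t \<beta>) = flow_velocity k U0 t \<beta>\<close>
  in \<beta> at \<alpha>. The identity holds for all \<beta> because a global solution has a path
  from every initial point.\<close>

lemma global_solution_gradient:
  assumes k: "k \<noteq> 0" and U0: "smooth_on UNIV U0" and sol: "global_smooth_solution k U0 \<Omega> U"
    and X: "particle_path \<Omega> U \<alpha> X"
  defines "A \<equiv> jacobian U0 (at \<alpha>)"
  shows "jacobian (U t) (at (X t)) *v flow_gradient k A t y
      = cos (2 * k * t) *\<^sub>R (A *v y) + sin (2 * k * t) *\<^sub>R (J *v (A *v y))"
proof -
  have sol': "smooth_solution k U0 \<Omega> U" using sol by (simp add: global_smooth_solution_def)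
  have A: "(U0 has_derivative (*v) A) (at \<alpha>)"
    unfolding A_def by (rule has_derivative_jacobian[OF U0]) simp
  have vel: "U t (flow k U0 t \<beta>) = flow_velocity k U0 t \<beta>" for \<beta>
  proof -
    obtain Y where "particle_path \<Omega> U \<beta> Y"
      using sol unfolding global_smooth_solution_def by blast
    then show ?thesis using particle_path_eq_flow[OF k sol'] by metis
  qed
  have Xt: "X t = flow k U0 t \<alpha>" using particle_path_eq_flow[OF k sol' X] by simp
  have "(t, X t) \<in> \<Omega>" using X by (simp add: particle_path_def)
  then obtain G' where "((\<lambda>(t, x). U t x) has_derivative G') (at (t, X t))"
    using sol' smooth_on_differentiable unfolding smooth_solution_def differentiable_def by metis
  then have "U t differentiable (at (X t))"
    using material_derivative(1) differentiableI by blast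
  then have "(U t has_derivative (*v) (jacobian (U t) (at (X t)))) (at (flow k U0 t \<alpha>))"
    using jacobian_works Xt by metis
  from has_derivative_compose[OF flow_space_derivative[OF A] this]
  have "(flow_velocity k U0 t has_derivative
      (\<lambda>y. jacobian (U t) (at (X t)) *v flow_gradient k A t y)) (at \<alpha>)"
    by (simp add: vel)
  from has_derivative_unique[OF this flow_velocity_space_derivative[OF A]]
  show ?thesis by meson
qed

section \<open>The threshold\<close>

text \<open>\<open>osc_a\<close> and \<open>osc_b\<close> are the amplitudes a and b in
  \<open>flow_det_trig\<close>.\<close>

definition osc_a :: "real \<Rightarrow> real^2^2 \<Rightarrow> real" where
  "osc_a k A = divergence A / (2 * k)"

definition osc_b :: "real \<Rightarrow> real^2^2 \<Rightarrow> real" where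
  "osc_b k A = (det A / k - vorticity A) / (2 * k)"

lemma flow_det_trig:
  "k \<noteq> 0 \<Longrightarrow> flow_det k A t
    = 1 + osc_b k A + osc_a k A * sin (2 * k * t) - osc_b k A * cos (2 * k * t)"
  by (simp add: flow_det_def osc_a_def osc_b_def flow_sin_def flow_cos_def field_simps)

lemma threshold_osc:
  fixes U0 :: "real^2 \<Rightarrow> real^2" and \<alpha> :: "real^2"
  assumes "k \<noteq> 0"
  defines "A \<equiv> jacobian U0 (at \<alpha>)"
  shows "threshold k U0 \<alpha> = 4 * k\<^sup>2 * (1 + 2 * osc_b k A - (osc_a k A)\<^sup>2)"
  using assms
  by (simp add: threshold_def spectral_gap_sq_def osc_a_def osc_b_def field_simps power2_eq_square)

text \<open>The minimum over x is 1 + b - sqrt (a^2 + b^2); it is positive iff 1 + b > 0 and a^2 +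
  b^2 < (1 + b)^2.\<close>

lemma oscillation_pos_iff:
  fixes a b :: real
  shows "(\<forall>x. 0 < 1 + b + a * sin x - b * cos x) \<longleftrightarrow> a\<^sup>2 < 1 + 2 * b"
proof
  assume pos: "\<forall>x. 0 < 1 + b + a * sin x - b * cos x"
  define r where "r = sqrt (a\<^sup>2 + b\<^sup>2)"
  have r2: "r\<^sup>2 = a\<^sup>2 + b\<^sup>2" by (simp add: r_def)
  show "a\<^sup>2 < 1 + 2 * b"
  proof (cases "r = 0")
    case True
    then show ?thesis using r2 by (simp add: add_nonneg_eq_0_iff)
  next
    case False
    have r: "r > 0" using False by (simp add: r_def add_nonneg_nonneg order_less_le)
    have "(b / r)\<^sup>2 + (- a / r)\<^sup>2 = (a\<^sup>2 + b\<^sup>2) / r\<^sup>2"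
      by (simp add: power_divide add_divide_distrib)
    then have "(b / r)\<^sup>2 + (- a / r)\<^sup>2 = 1"
      using False by (simp add: r2[symmetric])
    \<comment> \<open>The minimum is attained where (cos x, sin x) = (b, -a) / r.\<close>
    then obtain x where x: "b / r = cos x" "- a / r = sin x"
      by (rule sincos_total_2pi)
    have "a * sin x - b * cos x = - ((a\<^sup>2 + b\<^sup>2) / r)"
      unfolding x[symmetric] by (simp add: power2_eq_square add_divide_distrib)
    also have "\<dots> = - r" using False unfolding r2[symmetric] by (simp add: power2_eq_square)
    finally have "r < 1 + b" using pos[rule_format, of x] by linarith
    then have "r\<^sup>2 < (1 + b)\<^sup>2" using r by (intro power_strict_mono) auto
    then show ?thesis using r2 by (simp add: power2_eq_square algebra_simps)
  qed
next
  assume ab: "a\<^sup>2 < 1 + 2 * b"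
  show "\<forall>x. 0 < 1 + b + a * sin x - b * cos x"
  proof
    fix x
    have b: "0 < 1 + b" using ab zero_le_power2[of a] by linarith
    \<comment> \<open>Two-square identity; dropping the second square leaves the Cauchy-Schwarz
      bound.\<close>
    have "(a * s - b * c)\<^sup>2 + (a * c + b * s)\<^sup>2 = (a\<^sup>2 + b\<^sup>2) * (s\<^sup>2 + c\<^sup>2)" for s c
      by (simp add: power2_eq_square algebra_simps)
    from this[of "sin x" "cos x"]
    have "(a * sin x - b * cos x)\<^sup>2 + (a * cos x + b * sin x)\<^sup>2 = a\<^sup>2 + b\<^sup>2" by simp
    then have "(a * sin x - b * cos x)\<^sup>2 \<le> a\<^sup>2 + b\<^sup>2"
      using zero_le_power2[of "a * cos x + b * sin x"] by linarith
    also have "\<dots> < (1 + b)\<^sup>2" using ab by (simp add: power2_eq_square algebra_simps)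
    finally have "\<bar>a * sin x - b * cos x\<bar> < 1 + b"
      using b power2_less_imp_less[of "\<bar>a * sin x - b * cos x\<bar>" "1 + b"] by simp
    then show "0 < 1 + b + a * sin x - b * cos x" by linarith
  qed
qed

lemma threshold_pos_iff:
  assumes "k > 0"
  shows "threshold k U0 \<alpha> > 0 \<longleftrightarrow> (\<forall>t. flow_det k (jacobian U0 (at \<alpha>)) t > 0)"
proof -
  let ?a = "osc_a k (jacobian U0 (at \<alpha>))" and ?b = "osc_b k (jacobian U0 (at \<alpha>))"
  have "threshold k U0 \<alpha> > 0 \<longleftrightarrow> ?a\<^sup>2 < 1 + 2 * ?b"
    using assms by (simp add: threshold_osc zero_less_mult_iff)
  also have "\<dots> \<longleftrightarrow> (\<forall>x. 0 < 1 + ?b + ?a * sin x - ?b * cos x)"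
    by (rule oscillation_pos_iff[symmetric])
  also have "\<dots> \<longleftrightarrow> (\<forall>t. 0 < 1 + ?b + ?a * sin (2 * k * t) - ?b * cos (2 * k * t))"
  proof (intro iffI allI)
    fix x assume *: "\<forall>t. 0 < 1 + ?b + ?a * sin (2 * k * t) - ?b * cos (2 * k * t)"
    show "0 < 1 + ?b + ?a * sin x - ?b * cos x"
      using *[rule_format, of "x / (2 * k)"] assms by simp
  qed blast
  finally show ?thesis using assms by (simp add: flow_det_trig)
qed

lemma continuous_flow_det: "k \<noteq> 0 \<Longrightarrow> continuous_on S (flow_det k A)"
  unfolding flow_det_def flow_sin_def flow_cos_def by (auto intro!: continuous_intros)

text \<open>Along a path the flow gradient has nonzero determinant by
  \<open>transported_gradient\<close>. The determinant is 1 at time 0, so by continuity it stays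
  positive.\<close>

lemma global_solution_threshold:
  assumes k: "k > 0" and "smooth_on UNIV U0" "global_smooth_solution k U0 \<Omega> U"
  shows "threshold k U0 \<alpha> > 0"
proof -
  let ?D = "flow_det k (jacobian U0 (at \<alpha>))"
  obtain X where "particle_path \<Omega> U \<alpha> X"
    using assms(3) unfolding global_smooth_solution_def by blast
  then have nz: "?D t \<noteq> 0" for t
    using transported_gradient(1)[OF _ global_solution_gradient[OF _ assms(2,3)]] k by simp
  have D0: "?D 0 = 1" by (simp add: flow_det_def flow_sin_def flow_cos_def)
  have conn: "connected (range ?D)"
    using k by (intro connected_continuous_image continuous_flow_det) auto
  have "?D t > 0" for t
  proof (rule ccontr)
    assume "\<not> ?D t > 0"
    then have "0 \<in> range ?D"
      using connectedD_interval[OF conn, of "?D t" "?D 0" 0] D0 by auto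
    then show False using nz by force
  qed
  then show ?thesis using threshold_pos_iff[OF k] by blast
qed

section \<open>Construction of the global solution\<close>

text \<open>\<open>(A *v v) \<bullet> (J *v v) - k * (v \<bullet> v)\<close> is a binary quadratic
  form in the coordinates of v, and the threshold is minus its discriminant. Positivity makes the
  form definite.\<close>

lemma threshold_quadratic_form:
  assumes pos: "4 * k * (k - vorticity A) - spectral_gap_sq A > 0"
    and eq: "(A *v v) \<bullet> (J *v v) = k * (v \<bullet> v)"
  shows "v = 0"
proof -
  define x y where "x = v $ 1" and "y = v $ 2"
  define \<alpha> \<beta> \<gamma> where "\<alpha> = - A $ 2 $ 1 - k" and "\<beta> = A $ 1 $ 1 - A $ 2 $ 2" and "\<gamma> = A $ 1 $ 2 - k"
  define th where "th = 4 * k * (k - vorticity A) - spectral_gap_sq A"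
  have th: "th = 4 * \<alpha> * \<gamma> - \<beta>\<^sup>2"
    by (simp add: th_def \<alpha>_def \<beta>_def \<gamma>_def spectral_gap_sq_def divergence_def vorticity_def
        trace_def sum_2 det_2 power2_eq_square algebra_simps)
  have q: "\<alpha> * x\<^sup>2 + \<beta> * x * y + \<gamma> * y\<^sup>2 = 0"
    using eq[unfolded J_mult] by (simp add: \<alpha>_def \<beta>_def \<gamma>_def x_def y_def inner_vec_def sum_2
        matrix_vector_mult_def power2_eq_square algebra_simps)
  have "(2 * \<alpha> * x + \<beta> * y)\<^sup>2 + th * y\<^sup>2 = 4 * \<alpha> * (\<alpha> * x\<^sup>2 + \<beta> * x * y + \<gamma> * y\<^sup>2)"
    "(2 * \<gamma> * y + \<beta> * x)\<^sup>2 + th * x\<^sup>2 = 4 * \<gamma> * (\<alpha> * x\<^sup>2 + \<beta> * x * y + \<gamma> * y\<^sup>2)"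
    by (simp_all add: th power2_eq_square algebra_simps)
  then have "th * y\<^sup>2 \<le> 0" "th * x\<^sup>2 \<le> 0"
    unfolding q using zero_le_power2[of "2 * \<alpha> * x + \<beta> * y"] zero_le_power2[of "2 * \<gamma> * y + \<beta> * x"]
    by linarith+
  then have "x = 0" "y = 0"
    using pos by (auto simp: th_def[symmetric] mult_le_0_iff)
  then show ?thesis by (simp add: vec_eq_iff forall_2 x_def y_def)
qed

text \<open>If two particles met, then \<open>U\<^sub>0(\<beta>) - U\<^sub>0(\<alpha>) - k J (\<beta> - \<alpha>)\<close> would be orthogonal to
  \<open>J (\<beta> - \<alpha>)\<close>. By Rolle's theorem the same would hold for the derivative of \<open>U\<^sub>0 - k J\<close> in the
  direction \<open>\<beta> - \<alpha>\<close> at a point of the segment, which the threshold condition excludes.\<close>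

lemma flow_inj:
  assumes k: "k > 0" and U0: "smooth_on UNIV U0" and th: "\<And>\<alpha>. threshold k U0 \<alpha> > 0"
  shows "inj (flow k U0 t)"
proof (rule injI)
  fix \<alpha> \<beta> assume eq: "flow k U0 t \<alpha> = flow k U0 t \<beta>"
  define s c where "s = flow_sin k t" and "c = flow_cos k t"
  have circ: "k * (s\<^sup>2 + c\<^sup>2) = c"
    using flow_circle[of k t] k by (simp add: s_def c_def)
  define v w where "v = \<beta> - \<alpha>" and "w = U0 \<beta> - U0 \<alpha>"
  have "v = - (s *\<^sub>R w + c *\<^sub>R (J *v w))"
    using eq by (simp add: flow_def v_def w_def s_def c_def matrix_vector_mult_diff_distrib
        algebra_simps)
  then have v: "v $ 1 = - (s * w $ 1 + c * w $ 2)" "v $ 2 = - (s * w $ 2 - c * w $ 1)"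
    by (simp_all add: J_mult)
  \<comment> \<open>Since v = -(s + c J) w, the squared length of v is (s^2 + c^2) times that of w,
    while w . J v is c times that of w; the circle relation links the two factors.\<close>
  have "k * (v \<bullet> v) = k * (s\<^sup>2 + c\<^sup>2) * (w \<bullet> w)"
    by (simp add: inner_vec_def sum_2 v power2_eq_square algebra_simps)
  moreover have "w \<bullet> (J *v v) = c * (w \<bullet> w)"
    by (simp add: inner_vec_def sum_2 J_mult v algebra_simps)
  ultimately have wv: "w \<bullet> (J *v v) = k * (v \<bullet> v)" unfolding circ by simp
  \<comment> \<open>The linear term makes the values at 0 and 1 agree; a zero of the derivative is a
    point where \<open>threshold_quadratic_form\<close> applies.\<close>
  define h where "h = (\<lambda>\<sigma>. U0 (\<alpha> + \<sigma> *\<^sub>R v) \<bullet> (J *v v) - \<sigma> * (k * (v \<bullet> v)))"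
  define A where "A \<sigma> = jacobian U0 (at (\<alpha> + \<sigma> *\<^sub>R v))" for \<sigma>
  have h': "(h has_derivative (\<lambda>x. (x *\<^sub>R (A \<sigma> *v v)) \<bullet> (J *v v) - x * (k * (v \<bullet> v)))) (at \<sigma>)" for \<sigma>
  proof -
    have "((\<lambda>\<sigma>. U0 (\<alpha> + \<sigma> *\<^sub>R v)) has_derivative (\<lambda>x. A \<sigma> *v (x *\<^sub>R v))) (at \<sigma>)"
      unfolding A_def
      by (rule has_derivative_compose[of "\<lambda>\<sigma>. \<alpha> + \<sigma> *\<^sub>R v" "\<lambda>x. x *\<^sub>R v",
            OF _ has_derivative_jacobian[OF U0]])
        (auto intro!: derivative_eq_intros)
    then show ?thesis
      unfolding h_def by (auto intro!: derivative_eq_intros simp: matrix_vector_mult_scaleR)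
  qed
  have "\<exists>z. 0 < z \<and> z < 1 \<and> (\<lambda>x. (x *\<^sub>R (A z *v v)) \<bullet> (J *v v) - x * (k * (v \<bullet> v))) = (\<lambda>x. 0)"
  proof (rule Rolle_deriv)
    show "h 0 = h 1" using wv by (simp add: h_def w_def v_def inner_diff_left)
    show "continuous_on {0..1} h"
      using h' by (intro continuous_at_imp_continuous_on ballI has_derivative_continuous) blast
  qed (use h' in auto)
  then obtain z where "(\<lambda>x. (x *\<^sub>R (A z *v v)) \<bullet> (J *v v) - x * (k * (v \<bullet> v))) = (\<lambda>x. 0)"
    by blast
  from fun_cong[OF this, of 1] have "(A z *v v) \<bullet> (J *v v) = k * (v \<bullet> v)" by simp
  then have "v = 0"
    using threshold_quadratic_form th[of "\<alpha> + z *\<^sub>R v"] by (simp add: threshold_def A_def)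
  then show "\<alpha> = \<beta>" by (simp add: v_def)
qed

text \<open>A preimage of y is a fixed point of the map f taking \<alpha> to y - (s + c J)
  U0(\<alpha>). Sublinear growth makes f send a large ball into itself, so Brouwer's theorem
  applies.\<close>

lemma flow_surj:
  assumes U0: "continuous_on UNIV U0" and sub: "sublinear_growth U0"
  shows "surj (flow k U0 t)"
proof -
  have "\<exists>\<alpha>. flow k U0 t \<alpha> = y" for y
  proof -
    define s c where "s = flow_sin k t" and "c = flow_cos k t"
    define C where "C = \<bar>s\<bar> + \<bar>c\<bar> + 1"
    have C: "C > 0" by (simp add: C_def add_nonneg_pos)
    \<comment> \<open>With this bound the \<open>U0\<close> part of f has at most half the norm of
      its argument far out.\<close>
    have "\<forall>\<^sub>F x in at_infinity. norm (norm (U0 x) / norm x) < 1 / (2 * C)"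
      using sub C unfolding sublinear_growth_def tendsto_iff by (simp add: dist_norm)
    then obtain b where b: "\<And>x. b \<le> norm x \<Longrightarrow> norm (U0 x) / norm x < 1 / (2 * C)"
      by (auto simp: eventually_at_infinity)
    \<comment> \<open>Taking at least radius 1 ensures that outside this ball the norm used as
      divisor is nonzero.\<close>
    have "bounded (U0 ` cball 0 (max b 1))"
      by (intro compact_imp_bounded compact_continuous_image continuous_on_subset[OF U0]) auto
    then obtain K where K: "K > 0" "\<And>x. norm x \<le> max b 1 \<Longrightarrow> norm (U0 x) \<le> K"
      by (force simp: bounded_pos)
    \<comment> \<open>Inside the small ball f is bounded by norm y + C K; outside it, norm y and the
      \<open>U0\<close> part each take at most R / 2.\<close>
    define R where "R = 2 * norm y + C * K"
    have "R > 0" using C K by (simp add: R_def add_nonneg_pos)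
    define f where "f \<alpha> = y - s *\<^sub>R U0 \<alpha> - c *\<^sub>R (J *v U0 \<alpha>)" for \<alpha>
    have JU: "norm (J *v x) = norm x" for x
      by (simp add: J_mult norm_eq_sqrt_inner inner_vec_def sum_2 add.commute)
    have "norm (f \<alpha>) \<le> R" if \<alpha>: "norm \<alpha> \<le> R" for \<alpha>
    proof -
      have "norm (f \<alpha>) \<le> norm y + \<bar>s\<bar> * norm (U0 \<alpha>) + \<bar>c\<bar> * norm (U0 \<alpha>)"
        unfolding f_def using norm_triangle_ineq4[of "y - s *\<^sub>R U0 \<alpha>" "c *\<^sub>R (J *v U0 \<alpha>)"]
          norm_triangle_ineq4[of y "s *\<^sub>R U0 \<alpha>"] by (simp add: JU)
      then have f: "norm (f \<alpha>) \<le> norm y + C * norm (U0 \<alpha>)"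
        using norm_ge_zero[of "U0 \<alpha>"] unfolding C_def distrib_right by linarith
      show ?thesis
      proof (cases "norm \<alpha> \<le> max b 1")
        case True
        then have "C * norm (U0 \<alpha>) \<le> C * K" using K C by simp
        then show ?thesis using f norm_ge_zero[of y] unfolding R_def by linarith
      next
        case False
        then have "norm (U0 \<alpha>) / norm \<alpha> < 1 / (2 * C)" "norm \<alpha> > 0" using b by auto
        then have "C * norm (U0 \<alpha>) \<le> norm \<alpha> / 2" using C by (simp add: field_simps)
        moreover have "norm y \<le> R / 2" using C K by (simp add: R_def)
        ultimately show ?thesis using f \<alpha> by linarith
      qed
    qed
    then have "f \<in> cball 0 R \<rightarrow> cball 0 R" by simp
    moreover have "continuous_on (cball 0 R) f"
      unfolding f_def
      by (intro continuous_intros continuous_on_subset[OF U0]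
          bounded_linear.continuous_on[OF matrix_vector_mul_bounded_linear]) auto
    ultimately obtain \<alpha> where "f \<alpha> = \<alpha>"
      using brouwer_ball[OF \<open>R > 0\<close>] by metis
    then have "flow k U0 t \<alpha> = y"
      by (simp add: flow_def f_def s_def c_def algebra_simps)
    then show ?thesis ..
  qed
  then show ?thesis by (metis surjI)
qed

section \<open>Smoothness of the inverse of the space-time flow map\<close>

text \<open>With time kept as a coordinate, one inverse-function argument gives smoothness jointly
  in time and space.\<close>

definition flow_map :: "real \<Rightarrow> (real^2 \<Rightarrow> real^2) \<Rightarrow> real \<times> (real^2) \<Rightarrow> real \<times> (real^2)" where
  "flow_map k U0 p = (fst p, flow k U0 (fst p) (snd p))"

lemma flow_map_derivative:
  assumes k: "k \<noteq> 0" and U0: "smooth_on UNIV U0"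
  shows "(flow_map k U0 has_derivative (\<lambda>q. (fst q, fst q *\<^sub>R flow_velocity k U0 (fst p) (snd p)
      + flow_gradient k (jacobian U0 (at (snd p))) (fst p) (snd q)))) (at p)"
proof -
  let ?A = "jacobian U0 (at (snd p))"
  have 1: "((\<lambda>p. U0 (snd p)) has_derivative (\<lambda>q. ?A *v snd q)) (at p)"
    by (rule has_derivative_compose[of snd snd, OF _ has_derivative_jacobian[OF U0]])
      (auto intro!: derivative_eq_intros)
  have 2: "((\<lambda>p. J *v U0 (snd p)) has_derivative (\<lambda>q. J *v (?A *v snd q))) (at p)"
    by (rule bounded_linear.has_derivative[OF matrix_vector_mul_bounded_linear 1])
  have 3: "((\<lambda>p::real \<times> (real^2). flow_sin k (fst p)) has_derivative
      (\<lambda>q. fst q * cos (2 * k * fst p))) (at p)"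
    by (rule DERIV_compose_FDERIV[OF flow_sin_deriv[OF k]]) (auto intro!: derivative_eq_intros)
  have 4: "((\<lambda>p::real \<times> (real^2). flow_cos k (fst p)) has_derivative
      (\<lambda>q. fst q * sin (2 * k * fst p))) (at p)"
    by (rule DERIV_compose_FDERIV[OF flow_cos_deriv[OF k]]) (auto intro!: derivative_eq_intros)
  show ?thesis
    unfolding flow_map_def[abs_def] flow_def flow_velocity_def flow_gradient_def
    by (rule derivative_eq_intros 1 2 3 4 refl)+ (simp add: fun_eq_iff algebra_simps)
qed

text \<open>Inverse of the block triangular derivative of \<open>flow_map\<close>: subtract the
  drift due to the time increment, then apply adjugate over determinant. The argument
  \<open>p\<close> is the preimage point, given by time and particle label.\<close>

definition flow_map_inverse_derivative ::
    "real \<Rightarrow> (real^2 \<Rightarrow> real^2) \<Rightarrow> real \<times> (real^2) \<Rightarrow> real \<times> (real^2) \<Rightarrow> real \<times> (real^2)" where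
  "flow_map_inverse_derivative k U0 p q =
    (let t = fst p; A = jacobian U0 (at (snd p));
         z = snd q - fst q *\<^sub>R flow_velocity k U0 t (snd p)
     in (fst q, inverse (flow_det k A t) *\<^sub>R
          ((2 + flow_sin k t * divergence A - flow_cos k t * vorticity A) *\<^sub>R z
            - flow_gradient k A t z)))"

lemma flow_gradient_scaleR: "flow_gradient k A t (c *\<^sub>R y) = c *\<^sub>R flow_gradient k A t y"
  by (simp add: flow_gradient_def matrix_vector_mult_scaleR scaleR_add_right mult.commute)

text \<open>Injectivity supplies the inverse map and the adjugate formula a right inverse of the
  derivative; the inverse function theorem then yields differentiability at the image point.\<close>

lemma flow_map_inverse_has_derivative:
  assumes k: "k > 0" and U0: "smooth_on UNIV U0"
    and D: "\<And>\<alpha> t. flow_det k (jacobian U0 (at \<alpha>)) t > 0" and inj: "inj (flow_map k U0)"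
  shows "(inv (flow_map k U0) has_derivative flow_map_inverse_derivative k U0 p)
      (at (flow_map k U0 p))"
proof -
  have k0: "k \<noteq> 0" using k by simp
  let ?F' = "\<lambda>q. (fst q, fst q *\<^sub>R flow_velocity k U0 (fst p) (snd p)
      + flow_gradient k (jacobian U0 (at (snd p))) (fst p) (snd q))"
  have 1: "(flow_map k U0 has_derivative ?F') (at p)"
    by (rule flow_map_derivative[OF k0 U0])
  have 2: "continuous_on UNIV (flow_map k U0)"
    using flow_map_derivative[OF k0 U0]
    by (intro continuous_at_imp_continuous_on ballI has_derivative_continuous) blast
  have 3: "?F' \<circ> flow_map_inverse_derivative k U0 p = id"
    using D[of "snd p" "fst p"]
    by (simp add: fun_eq_iff flow_map_inverse_derivative_def Let_def flow_gradient_scaleR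
        flow_gradient_adjugate[OF k0])
  show ?thesis
    by (rule has_derivative_inverse_strong[OF open_UNIV UNIV_I 2 _ 1 3]) (simp add: inj)
qed

text \<open>The derivative in \<open>ck_on\<close> is bound by an existential; uniqueness of
  derivatives identifies it with the Jacobian.\<close>

lemma ck_on_jacobian_mult:
  assumes "smooth_on UNIV U0"
  shows "ck_on n (\<lambda>\<alpha>. jacobian (U0 :: real^2 \<Rightarrow> real^2) (at \<alpha>) *v w) UNIV"
proof -
  have "ck_on (Suc n) U0 UNIV" using assms by (simp add: smooth_on_def)
  then show ?thesis
  proof (rule ck_on_SucE)
    fix U0' assume "\<And>x. x \<in> UNIV \<Longrightarrow> (U0 has_derivative U0' x) (at x)"
      and *: "\<And>v. ck_on n (\<lambda>x. U0' x v) UNIV"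
    then have "jacobian U0 (at \<alpha>) *v w = U0' \<alpha> w" for \<alpha>
      by (intro jacobian_mult) auto
    then show ?thesis using * by simp
  qed
qed

lemma ck_on_jacobian_entry:
  assumes "smooth_on UNIV U0"
  shows "ck_on n (\<lambda>\<alpha>. jacobian (U0 :: real^2 \<Rightarrow> real^2) (at \<alpha>) $ i $ j) UNIV"
proof -
  have "ck_on n (\<lambda>\<alpha>. (jacobian U0 (at \<alpha>) *v axis j 1) $ i) UNIV"
    by (rule ck_on_compose_linear[OF bounded_linear_vec_nth ck_on_jacobian_mult[OF assms]])
  then show ?thesis by (simp add: matrix_vector_mult_basis column_def)
qed

lemma
  fixes U0 :: "real^2 \<Rightarrow> real^2"
  assumes "smooth_on UNIV U0"
  shows ck_on_flow_velocity: "ck_on n (\<lambda>p. flow_velocity k U0 (fst p) (snd p)) UNIV"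
    and ck_on_flow_map_inverse_derivative:
      "(\<And>\<alpha> t. flow_det k (jacobian U0 (at \<alpha>)) t > 0) \<Longrightarrow>
        ck_on n (\<lambda>p. flow_map_inverse_derivative k U0 p q) UNIV"
proof -
  let ?A = "\<lambda>p :: real \<times> (real^2). jacobian U0 (at (snd p))"
  have fst: "ck_on n fst UNIV" and snd: "ck_on n snd UNIV"
    by (auto intro: ck_on_linear bounded_linear_fst bounded_linear_snd)
  have snd_compose: "ck_on n f UNIV \<Longrightarrow> ck_on n (\<lambda>p. f (snd p)) UNIV"
    for f :: "real^2 \<Rightarrow> 'b::real_normed_vector"
    by (rule ck_on_compose[OF _ _ snd]) auto
  have U0: "ck_on n (\<lambda>p. U0 (snd p)) UNIV"
    using assms by (intro snd_compose) (simp add: smooth_on_def)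
  have J: "ck_on n f UNIV \<Longrightarrow> ck_on n (\<lambda>p. J *v f p) UNIV" for f :: "real \<times> (real^2) \<Rightarrow> _"
    by (rule ck_on_compose_linear[OF matrix_vector_mul_bounded_linear])
  have "ck_on n (\<lambda>p::real \<times> (real^2). 2 * k * fst p) UNIV"
    by (intro ck_on_intros fst)
  note trig = ck_on_sin_cos[OF this, THEN conjunct1] ck_on_sin_cos[OF this, THEN conjunct2]
  have s: "ck_on n (\<lambda>p::real \<times> (real^2). flow_sin k (fst p)) UNIV"
    and c: "ck_on n (\<lambda>p::real \<times> (real^2). flow_cos k (fst p)) UNIV"
    unfolding flow_sin_def flow_cos_def divide_inverse by (intro ck_on_intros trig)+
  show V: "ck_on n (\<lambda>p. flow_velocity k U0 (fst p) (snd p)) UNIV"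
    unfolding flow_velocity_def by (intro ck_on_intros trig U0 J)
  have A: "ck_on n (\<lambda>p. ?A p $ i $ j) UNIV" for i j
    by (intro snd_compose ck_on_jacobian_entry assms)
  note entries = divergence_def trace_def vorticity_def det_2 sum_2 divide_inverse
  have D: "ck_on n (\<lambda>p. flow_det k (?A p) (fst p)) UNIV"
    unfolding flow_det_def entries by (intro ck_on_intros s c A)
  have tr: "ck_on n (\<lambda>p. 2 + flow_sin k (fst p) * divergence (?A p)
      - flow_cos k (fst p) * vorticity (?A p)) UNIV"
    unfolding entries by (intro ck_on_intros s c A)
  have grad: "ck_on n (\<lambda>p. flow_gradient k (?A p) (fst p) (z p)) UNIV"
    if z: "ck_on n z UNIV" for z
  proof -
    have "ck_on n (\<lambda>p. ?A p *v z p) UNIV"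
      by (rule ck_on_linear_family[OF open_UNIV _ _ z])
        (auto intro: snd_compose ck_on_jacobian_mult[OF assms])
    then show ?thesis
      unfolding flow_gradient_def by (intro ck_on_intros z s c J)
  qed
  assume pos: "\<And>\<alpha> t. flow_det k (jacobian U0 (at \<alpha>)) t > 0"
  have "ck_on n (\<lambda>p. inverse (flow_det k (?A p) (fst p))) UNIV"
    using pos by (intro ck_on_inverse D) (simp add: less_imp_neq[THEN not_sym])
  then show "ck_on n (\<lambda>p. flow_map_inverse_derivative k U0 p q) UNIV"
    unfolding flow_map_inverse_derivative_def Let_def by (intro ck_on_intros tr grad V)
qed

section \<open>The solution as velocity composed with the inverse flow\<close>

text \<open>The velocity at a space-time point is that of the unique particle found there, and the
  domain consists of the points reached by some particle.\<close>

lemma global_solution_exists: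
  assumes k: "k > 0" and U0: "smooth_on UNIV U0" and th: "\<And>\<alpha>. threshold k U0 \<alpha> > 0"
  shows "\<exists>U. global_smooth_solution k U0 (range (flow_map k U0)) U"
proof -
  have k0: "k \<noteq> 0" using k by simp
  define \<Psi> where "\<Psi> = flow_map k U0"
  define V where "V p = flow_velocity k U0 (fst p) (snd p)" for p
  define U where "U t x = V (inv \<Psi> (t, x))" for t x
  have D: "flow_det k (jacobian U0 (at \<alpha>)) t > 0" for \<alpha> t
    using th threshold_pos_iff[OF k] by blast
  have inj: "inj \<Psi>"
    unfolding \<Psi>_def flow_map_def[abs_def]
    by (rule injI) (auto simp: prod_eq_iff dest: injD[OF flow_inj[OF k U0 th]])
  have cont: "continuous_on UNIV \<Psi>"
    using flow_map_derivative[OF k0 U0] unfolding \<Psi>_def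
    by (intro continuous_at_imp_continuous_on ballI has_derivative_continuous) blast
  \<comment> \<open>Invariance of domain, for a continuous injection of space-time into
    itself.\<close>
  have op: "open (range \<Psi>)"
    using cont inj by (intro invariance_of_domain) auto
  have inv: "(inv \<Psi> has_derivative flow_map_inverse_derivative k U0 (inv \<Psi> q)) (at q)"
    if "q \<in> range \<Psi>" for q
    using flow_map_inverse_has_derivative[OF k U0 D inj[unfolded \<Psi>_def]] that inj
    by (auto simp: \<Psi>_def)
  \<comment> \<open>Bootstrap: the derivative of \<open>inv \<Psi>\<close> is a smooth function
    evaluated at \<open>inv \<Psi>\<close>, so each class yields the next.\<close>
  have ck_inv: "ck_on n (inv \<Psi>) (range \<Psi>)" for n
  proof (induction n)
    case 0
    show ?case using inv
      by (auto intro!: continuous_at_imp_continuous_on has_derivative_continuous)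
  next
    case (Suc n)
    show ?case
      by (rule ck_on_SucI[OF inv])
        (auto intro!: ck_on_compose[OF op _ Suc ck_on_flow_map_inverse_derivative[OF U0 D]])
  qed
  have "ck_on n (\<lambda>q. V (inv \<Psi> q)) (range \<Psi>)" for n
    unfolding V_def by (rule ck_on_compose[OF op _ ck_inv ck_on_flow_velocity[OF U0]]) auto
  then have smooth: "smooth_on (range \<Psi>) (\<lambda>(t, x). U t x)"
    by (simp add: smooth_on_def U_def case_prod_beta')
  have U: "U t (flow k U0 t \<alpha>) = flow_velocity k U0 t \<alpha>" for t \<alpha>
    using inv_f_f[OF inj, of "(t, \<alpha>)"] by (simp add: U_def V_def \<Psi>_def flow_map_def)
  have range: "(t, flow k U0 t \<alpha>) \<in> range \<Psi>" for t \<alpha>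
    by (auto simp: \<Psi>_def flow_map_def image_iff)
  \<comment> \<open>Every point of the domain lies on a particle path; the time derivative of the
    velocity along it is the left side of the equation.\<close>
  have pde: "vector_derivative (\<lambda>s. U s x) (at t) + jacobian (U t) (at x) *v U t x
      = (2 * k) *\<^sub>R (J *v U t x)" if tx: "(t, x) \<in> range \<Psi>" for t x
  proof -
    from tx obtain \<alpha> where x: "x = flow k U0 t \<alpha>"
      by (auto simp: \<Psi>_def flow_map_def)
    obtain G' where G': "((\<lambda>(t, x). U t x) has_derivative G') (at (t, x))"
      using smooth_on_differentiable[OF smooth tx] by (auto simp: differentiable_def)
    have "((\<lambda>s. flow_velocity k U0 s \<alpha>) has_vector_derivative G' (1, flow_velocity k U0 t \<alpha>)) (at t)"
      using has_vector_derivative_along_path[OF G'[unfolded x] flow_time_derivative[OF k0]]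
      by (simp add: U)
    then have "G' (1, flow_velocity k U0 t \<alpha>) = (2 * k) *\<^sub>R (J *v flow_velocity k U0 t \<alpha>)"
      using flow_velocity_time_derivative vector_derivative_unique_at by blast
    then show ?thesis
      using material_derivative(2)[OF G'] by (simp add: x U)
  qed
  have init: "(0, \<alpha>) \<in> range \<Psi> \<and> U 0 \<alpha> = U0 \<alpha>" for \<alpha>
    using range[of 0 \<alpha>] U[of 0 \<alpha>] by (simp add: flow_0 flow_velocity_0)
  have "smooth_solution k U0 (range \<Psi>) U"
    unfolding smooth_solution_def
  proof (intro conjI ballI)
    fix p assume "p \<in> range \<Psi>"
    then show "case p of (t, x) \<Rightarrow> vector_derivative (\<lambda>s. U s x) (at t)
        + jacobian (U t) (at x) *v U t x = (2 * k) *\<^sub>R (J *v U t x)"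
      by (cases p) (simp add: pde)
  qed (rule op smooth allI init)+
  moreover have "particle_path (range \<Psi>) U \<alpha> (\<lambda>t. flow k U0 t \<alpha>)" for \<alpha>
    using range flow_time_derivative[OF k0] by (simp add: particle_path_def flow_0 U)
  ultimately show ?thesis
    unfolding global_smooth_solution_def \<Psi>_def by blast
qed

lemma global_solution_exists_UNIV:
  assumes k: "k > 0" and U0: "smooth_on UNIV U0" and th: "\<And>\<alpha>. threshold k U0 \<alpha> > 0"
    and sub: "sublinear_growth U0"
  shows "\<exists>U. global_smooth_solution k U0 UNIV U"
proof -
  have "continuous_on UNIV U0"
    using U0 unfolding smooth_on_def by (metis ck_on.simps(1))
  then have "surj (flow k U0 t)" for t by (rule flow_surj[OF _ sub])
  then have "(t, x) \<in> range (flow_map k U0)" for t x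
    by (metis (no_types, lifting) flow_map_def fst_conv rangeI snd_conv surjD)
  then have "range (flow_map k U0) = UNIV" by auto
  then show ?thesis using global_solution_exists[OF k U0 th] by simp
qed

section \<open>Eigenvalues\<close>

lemma eigenvalues_iff:
  "l \<in> eigenvalues A \<longleftrightarrow> l\<^sup>2 - of_real (divergence A) * l + of_real (det A) = 0"
proof -
  define a b c e :: complex where
    "a = A $ 1 $ 1" and "b = A $ 1 $ 2" and "c = A $ 2 $ 1" and "e = A $ 2 $ 2"
  have ev: "map_matrix complex_of_real A *v v = l *s v \<longleftrightarrow>
      a * v $ 1 + b * v $ 2 = l * v $ 1 \<and> c * v $ 1 + e * v $ 2 = l * v $ 2" for v
    by (simp add: vec_eq_iff forall_2 matrix_vector_mult_def sum_2 map_matrix_def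
        a_def b_def c_def e_def)
  have nz: "v \<noteq> 0 \<longleftrightarrow> v $ 1 \<noteq> 0 \<or> v $ 2 \<noteq> 0" for v :: "complex^2"
    by (simp add: vec_eq_iff forall_2)
  have ch: "l\<^sup>2 - of_real (divergence A) * l + of_real (det A) = (l - a) * (l - e) - b * c"
    by (simp add: divergence_def trace_def sum_2 det_2 a_def b_def c_def e_def
        power2_eq_square algebra_simps)
  show ?thesis
    unfolding ch eigenvalues_def mem_Collect_eq ev nz
  proof
    assume "\<exists>v::complex^2. (v $ 1 \<noteq> 0 \<or> v $ 2 \<noteq> 0) \<and>
      a * v $ 1 + b * v $ 2 = l * v $ 1 \<and> c * v $ 1 + e * v $ 2 = l * v $ 2"
    then obtain v :: "complex^2" where v: "v $ 1 \<noteq> 0 \<or> v $ 2 \<noteq> 0"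
      and 1: "b * v $ 2 = (l - a) * v $ 1" and 2: "c * v $ 1 = (l - e) * v $ 2"
      by (auto simp: algebra_simps)
    have "((l - a) * (l - e) - b * c) * v $ 1 = 0"
    proof -
      have "(l - a) * (l - e) * v $ 1 = (l - e) * (b * v $ 2)" unfolding 1 by simp
      also have "\<dots> = b * (c * v $ 1)" unfolding 2 by simp
      finally show ?thesis by (simp add: left_diff_distrib)
    qed
    moreover have "((l - a) * (l - e) - b * c) * v $ 2 = 0"
    proof -
      have "(l - a) * (l - e) * v $ 2 = (l - a) * (c * v $ 1)" unfolding 2 by simp
      also have "\<dots> = c * (b * v $ 2)" unfolding 1 by simp
      finally show ?thesis by (simp add: left_diff_distrib)
    qed
    ultimately show "(l - a) * (l - e) - b * c = 0" using v by auto
  next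
    assume *: "(l - a) * (l - e) - b * c = 0"
    have ex: "\<exists>v::complex^2. (v $ 1 \<noteq> 0 \<or> v $ 2 \<noteq> 0) \<and>
        a * v $ 1 + b * v $ 2 = l * v $ 1 \<and> c * v $ 1 + e * v $ 2 = l * v $ 2"
      if "x \<noteq> 0 \<or> y \<noteq> 0" "a * x + b * y = l * x" "c * x + e * y = l * y" for x y
      using that by (intro exI[of _ "vector [x, y]"]) simp
    \<comment> \<open>A nonzero off-diagonal entry gives a nonzero vector killed by its row of A -
      l, and the vanishing determinant handles the other row. Otherwise the matrix is diagonal and
      unit vectors serve.\<close>
    consider "b \<noteq> 0" | "c \<noteq> 0" | "b = 0" "c = 0" "l = a" | "b = 0" "c = 0" "l = e"
      using * by (cases "b = 0"; cases "c = 0") auto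
    then show "\<exists>v::complex^2. (v $ 1 \<noteq> 0 \<or> v $ 2 \<noteq> 0) \<and>
      a * v $ 1 + b * v $ 2 = l * v $ 1 \<and> c * v $ 1 + e * v $ 2 = l * v $ 2"
    proof cases
      case 1
      then show ?thesis using * by (intro ex[of b "l - a"]) (auto simp: algebra_simps)
    next
      case 2
      then show ?thesis using * by (intro ex[of "l - e" c]) (auto simp: algebra_simps)
    next
      case 3
      then show ?thesis by (intro ex[of 1 0]) auto
    next
      case 4
      then show ?thesis by (intro ex[of 0 1]) auto
    qed
  qed
qed

text \<open>A square root that is continuous on the whole real line.\<close>

definition real_csqrt :: "real \<Rightarrow> complex" where
  "real_csqrt x = of_real (sqrt (max x 0)) + \<i> * of_real (sqrt (max (- x) 0))"

lemma real_csqrt_square: "(real_csqrt x)\<^sup>2 = of_real x"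
  by (cases "x \<ge> 0")
    (simp_all add: real_csqrt_def power_mult_distrib max_def of_real_power[symmetric]
      del: of_real_power)

lemma continuous_on_real_csqrt [continuous_intros]:
  "continuous_on S f \<Longrightarrow> continuous_on S (\<lambda>t. real_csqrt (f t))"
  unfolding real_csqrt_def by (intro continuous_intros)

text \<open>Quadratic formula with an arbitrary square root g, so that a branch continuous in time
  can be inserted.\<close>

lemma eigenvalues_eq:
  assumes "g\<^sup>2 = of_real (spectral_gap_sq A)"
  shows "eigenvalues A
    = {(of_real (divergence A) - g) / 2, (of_real (divergence A) + g) / 2}"
proof -
  have "l \<in> eigenvalues A \<longleftrightarrow>
      (l - (of_real (divergence A) - g) / 2) * (l - (of_real (divergence A) + g) / 2) = 0" for l
  proof -
    have "(l - (d - g) / 2) * (l - (d + g) / 2) = l\<^sup>2 - d * l + (d\<^sup>2 - g\<^sup>2) / 4" for d :: complex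
      by (simp add: power2_eq_square algebra_simps add_divide_distrib diff_divide_distrib)
    then have "(l - (of_real (divergence A) - g) / 2) * (l - (of_real (divergence A) + g) / 2)
        = l\<^sup>2 - of_real (divergence A) * l + ((of_real (divergence A))\<^sup>2 - g\<^sup>2) / 4" .
    also have "\<dots> = l\<^sup>2 - of_real (divergence A) * l + of_real (det A)"
      unfolding assms by (simp add: spectral_gap_sq_def)
    finally show ?thesis by (simp add: eigenvalues_iff)
  qed
  then show ?thesis
    by (intro set_eqI) (simp only: mult_eq_0_iff right_minus_eq insert_iff empty_iff simp_thms)
qed

section \<open>The period\<close>

text \<open>The substitution \<open>u = tan (x / 2)\<close>; the discriminant of the resulting quadratic is constant,
  so the integral does not depend on \<open>q\<close>.\<close>

lemma period_integral:
  fixes q :: real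
  assumes q: "0 < q" "q < 1"
  shows "integral {- (pi / 2)..pi / 2}
    (\<lambda>x. 1 / ((inverse q + q) + (inverse q - q) * sin x)) = pi / 2"
proof -
  define P Q where "P = inverse q + q" and "Q = inverse q - q"
  have PQ: "P * P = Q * Q + 4" using q by (simp add: P_def Q_def field_simps)
  have PQ0: "P > Q" "Q > 0"
    using q one_less_inverse[OF q] unfolding P_def Q_def by linarith+
  define F where "F x = arctan ((P * tan (x / 2) + Q) / 2)" for x :: real
  have F': "(F has_real_derivative 1 / (P + Q * sin x)) (at x)"
    if x: "x \<in> {- (pi / 2)..pi / 2}" for x
  proof -
    define c s where "c = cos (x / 2)" and "s = sin (x / 2)"
    have "- (pi / 2) < x / 2" "x / 2 < pi / 2"
      using x pi_gt_zero unfolding atLeastAtMost_iff by linarith+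
    then have c: "c > 0" unfolding c_def by (rule cos_gt_zero_pi)
    have cs: "c * c + s * s = 1"
      using sin_cos_squared_add[of "x / 2"] by (simp add: c_def s_def power2_eq_square)
    have sin: "sin x = 2 * s * c"
      using sin_double[of "x / 2"] by (simp add: c_def s_def)
    have "Q * sin x \<ge> - Q" using PQ0 sin_ge_minus_one[of x] mult_left_mono[of "- 1" "sin x" Q] by simp
    then have pos: "P + Q * sin x > 0" using PQ0 by linarith
    have tan: "tan (x / 2) = s / c" by (simp add: tan_def s_def c_def)
    have "((\<lambda>x. tan (x / 2)) has_real_derivative inverse (c\<^sup>2) * (1 / 2)) (at x)"
      unfolding c_def using c
      by (intro DERIV_chain2[OF DERIV_tan]) (auto intro!: derivative_eq_intros simp: c_def)
    from DERIV_cdivide[OF DERIV_add[OF DERIV_cmult[OF this, of P] DERIV_const[of Q]], of 2]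
    have "((\<lambda>x. (P * tan (x / 2) + Q) / 2) has_real_derivative
        P * (inverse (c\<^sup>2) * (1 / 2)) / 2) (at x)" by simp
    from DERIV_chain2[OF DERIV_arctan this]
    have "(F has_real_derivative
        P * (inverse (c\<^sup>2) * (1 / 2)) / 2 * inverse (1 + ((P * (s / c) + Q) / 2)\<^sup>2)) (at x)"
      unfolding F_def tan by (simp only: mult.commute)
    moreover have "P * (inverse (c\<^sup>2) * (1 / 2)) / 2 * inverse (1 + ((P * (s / c) + Q) / 2)\<^sup>2)
        = 1 / (P + Q * sin x)"
    proof -
      \<comment> \<open>Over the denominator 4 c^2, the relation \<open>PQ\<close> and the
        half-angle formula turn the numerator into P (P + Q sin x).\<close>
      have "1 + ((P * (s / c) + Q) / 2)\<^sup>2 = (4 * (c * c) + (P * s + Q * c)\<^sup>2) / (4 * c\<^sup>2)"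
        using c by (simp add: field_simps power2_eq_square)
      also have "4 * (c * c) + (P * s + Q * c)\<^sup>2
          = (Q * Q + 4) * (c * c) + P * P * (s * s) + 2 * P * Q * s * c"
        by (simp add: power2_eq_square algebra_simps)
      also have "\<dots> = P * P * (c * c + s * s) + 2 * P * Q * s * c"
        unfolding PQ[symmetric] by (simp add: algebra_simps)
      also have "\<dots> = P * (P + Q * sin x)"
        unfolding cs sin by (simp add: algebra_simps)
      finally have "1 + ((P * (s / c) + Q) / 2)\<^sup>2 = P * (P + Q * sin x) / (4 * c\<^sup>2)" .
      then show ?thesis using c pos PQ0 by (simp add: divide_simps)
    qed
    ultimately show ?thesis by (rule DERIV_cong)
  qed
  have "((\<lambda>x. 1 / (P + Q * sin x)) has_integral F (pi / 2) - F (- (pi / 2))) {- (pi / 2)..pi / 2}"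
    using F' by (intro fundamental_theorem_of_calculus)
      (auto simp: has_real_derivative_iff_has_vector_derivative[symmetric]
        intro: has_field_derivative_at_within)
  \<comment> \<open>As tan (pi / 4) = 1, the arguments at the two ends are (P + Q) / 2 = 1 / q and
    (Q - P) / 2 = -q; finally arctan q + arctan (1 / q) = pi / 2.\<close>
  moreover have "F (pi / 2) = arctan (inverse q)"
    by (simp add: F_def tan_45 P_def Q_def)
  moreover have "F (- (pi / 2)) = - arctan q"
    by (simp add: F_def tan_45 tan_minus P_def Q_def arctan_minus[symmetric])
  ultimately show ?thesis
    using q arctan_inverse[of q] unfolding P_def Q_def by (auto dest!: integral_unique)
qed

section \<open>The period formula and the rest point\<close>

text \<open>A nonzero denominator makes \<open>p0\<close> positive and the square root exceed 1.
  Division by zero would instead give \<open>p0\<close> and \<open>theta0\<close> the value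
  0.\<close>

lemma theta0_bounds:
  assumes "k > 0" "threshold k U0 \<alpha> > 0" "p0_denom k U0 \<alpha> \<noteq> 0"
  shows "0 < theta0 k U0 \<alpha>" "theta0 k U0 \<alpha> < 1"
proof -
  have "p0_denom k U0 \<alpha> > 0"
    using assms(3) by (simp add: p0_denom_def order_less_le add_nonneg_nonneg)
  then have "p0 k U0 \<alpha> > 0" using assms by (simp add: p0_def)
  then have "sqrt (1 + 8 * k * p0 k U0 \<alpha>) > 1" using assms by simp
  moreover have "r > 1 \<Longrightarrow> 0 < (r - 1) / (r + 1) \<and> (r - 1) / (r + 1) < 1" for r :: real
    by simp
  ultimately show "0 < theta0 k U0 \<alpha>" "theta0 k U0 \<alpha> < 1"
    unfolding theta0_def by blast+
qed

text \<open>The integrand depends on the path through \<open>theta0\<close>, the value of the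
  integral does not.\<close>

lemma path_period_eq:
  assumes "k > 0" "threshold k U0 \<alpha> > 0" "p0_denom k U0 \<alpha> \<noteq> 0"
  shows "path_period k U0 \<alpha> = pi / k"
  unfolding path_period_def period_integral[OF theta0_bounds[OF assms]] by simp

text \<open>By \<open>threshold_osc\<close> the root of the threshold is 2 k iff 2 b = a^2; together
  with zero divergence this is a = b = 0, the rest point.\<close>

lemma p0_denom_eq_0_iff:
  assumes "k > 0" "threshold k U0 \<alpha> > 0"
  defines "A \<equiv> jacobian U0 (at \<alpha>)"
  shows "p0_denom k U0 \<alpha> = 0 \<longleftrightarrow> osc_a k A = 0 \<and> osc_b k A = 0"
proof -
  have th: "threshold k U0 \<alpha> = (2 * k)\<^sup>2 * (1 + 2 * osc_b k A - (osc_a k A)\<^sup>2)"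
    using assms(1) by (simp add: threshold_osc A_def)
  have "p0_denom k U0 \<alpha> = 0 \<longleftrightarrow> divergence A = 0 \<and> sqrt (threshold k U0 \<alpha>) = 2 * k"
    by (simp add: p0_denom_def A_def add_nonneg_eq_0_iff)
  also have "sqrt (threshold k U0 \<alpha>) = 2 * k \<longleftrightarrow> threshold k U0 \<alpha> = (2 * k)\<^sup>2"
    using assms(1,2) by (metis less_eq_real_def mult_pos_pos real_sqrt_unique real_sqrt_pow2 zero_less_numeral)
  also have "divergence A = 0 \<longleftrightarrow> osc_a k A = 0"
    using assms(1) by (simp add: osc_a_def)
  finally show ?thesis using assms(1) th by auto
qed

text \<open>If the logarithmic derivative of \<open>E\<close> is \<open>s\<close>-periodic then \<open>E (x + s) = K * E x\<close> for a
  constant \<open>K\<close>, and comparing means over a full period gives \<open>K = 1\<close>.\<close>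

lemma oscillation_least_period:
  fixes a b s :: real
  defines "E \<equiv> \<lambda>x. 1 + b + a * sin x - b * cos x"
    and "E' \<equiv> \<lambda>x. a * cos x + b * sin x"
  assumes pos: "\<And>x. E x > 0" and per: "\<And>x. E' (x + s) / E (x + s) = E' x / E x"
    and s: "0 < s" "s < 2 * pi"
  shows "a = 0 \<and> b = 0"
proof -
  have dE: "(E has_real_derivative E' x) (at x)" for x
    unfolding E_def E'_def by (auto intro!: derivative_eq_intros)
  have dEs: "((\<lambda>x. E (x + s)) has_real_derivative E' (x + s)) (at x)" for x
    unfolding E_def E'_def by (auto intro!: derivative_eq_intros)
  define K where "K = E (0 + s) / E 0"
  have "((\<lambda>x. E (x + s) / E x) has_real_derivative 0) (at x)" for x
  proof -
    have nz: "E x \<noteq> 0" "E (x + s) \<noteq> 0" using pos less_irrefl by metis+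
    then have "E' (x + s) * E x - E (x + s) * E' x = 0"
      using per[of x] by (simp add: field_simps)
    then show ?thesis
      using DERIV_divide[OF dEs dE, of x] nz by simp
  qed
  then have "E (x + s) / E x = K" for x
    unfolding K_def by (intro DERIV_isconst_all allI)
  then have K: "E (x + s) = K * E x" for x
    using pos[of x] by (metis less_irrefl nonzero_divide_eq_eq)
  \<comment> \<open>Opposite phases replace the integral mean: sin and cos change sign under a shift
    by pi.\<close>
  have mean: "E x + E (x + pi) = 2 * (1 + b)" for x by (simp add: E_def)
  have "2 * (1 + b) = E (0 + s) + E (pi + s)"
    using mean[of s] by (simp add: add.commute)
  also have "\<dots> = K * (E 0 + E pi)" unfolding K distrib_left ..
  also have "\<dots> = K * (2 * (1 + b))" using mean[of 0] by simp
  finally have "2 * (1 + b) = K * (2 * (1 + b))" .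
  moreover have "2 * (1 + b) > 0"
    unfolding mean[of 0, symmetric] by (intro add_pos_pos pos)
  ultimately have "K = 1" by simp
  then have "a * sin s - b * cos s = - b" "a * cos s + b * sin s = a"
    using K[of 0] K[of "pi / 2"] by (simp_all add: E_def sin_add cos_add)
  \<comment> \<open>The two equations say that a rotation through the angle s fixes the vector (a,
    b).\<close>
  then have "(a\<^sup>2 + b\<^sup>2) * (1 - cos s) = 0" by algebra
  moreover have "cos s \<noteq> 1"
  proof -
    have "sin (s / 2) > 0" using s by (intro sin_gt_zero) auto
    then show ?thesis using cos_double_sin[of "s / 2"] by simp
  qed
  ultimately show ?thesis by (simp add: add_nonneg_eq_0_iff)
qed

section \<open>The orbit of a particle\<close>

lemma periodic_trig:
  assumes "k \<noteq> 0"
  shows "sin (2 * k * (t + pi / k)) = sin (2 * k * t)"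
    and "cos (2 * k * (t + pi / k)) = cos (2 * k * t)"
proof -
  have "2 * k * (t + pi / k) = 2 * k * t + 2 * pi"
    using assms by (simp add: field_simps)
  then show "sin (2 * k * (t + pi / k)) = sin (2 * k * t)"
    "cos (2 * k * (t + pi / k)) = cos (2 * k * t)" by simp_all
qed

text \<open>The eigenvalues are labelled through \<open>real_csqrt\<close>, which keeps both
  branches continuous also at zeros of the gap.\<close>

definition path_orbit :: "(real \<Rightarrow> real^2^2) \<Rightarrow> real \<Rightarrow> real \<times> complex \<times> complex \<times> real" where
  "path_orbit M t = (vorticity (M t),
     (of_real (divergence (M t)) - real_csqrt (spectral_gap_sq (M t))) / 2,
     (of_real (divergence (M t)) + real_csqrt (spectral_gap_sq (M t))) / 2, divergence (M t))"

text \<open>\<open>transported_gradient\<close> writes divergence, determinant and vorticity as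
  quotients of trigonometric expressions in 2 k t, hence the period pi / k; the divergence alone
  excludes shorter ones.\<close>

lemma
  fixes A :: "real^2^2" and M :: "real \<Rightarrow> real^2^2"
  assumes k: "k > 0" and D: "\<And>t. flow_det k A t > 0"
    and MF: "\<And>t y. M t *v flow_gradient k A t y
      = cos (2 * k * t) *\<^sub>R (A *v y) + sin (2 * k * t) *\<^sub>R (J *v (A *v y))"
  shows continuous_divergence: "continuous_on UNIV (\<lambda>t. divergence (M t))"
    and continuous_spectral_gap_sq: "continuous_on UNIV (\<lambda>t. spectral_gap_sq (M t))"
    and stationary_path_orbit: "osc_a k A = 0 \<Longrightarrow> osc_b k A = 0 \<Longrightarrow> stationary_orbit (path_orbit M)"
    and periodic_path_orbit: "\<not> (osc_a k A = 0 \<and> osc_b k A = 0) \<Longrightarrow>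
      periodic_orbit (path_orbit M) (pi / k)"
proof -
  have k0: "k \<noteq> 0" using k by simp
  let ?a = "osc_a k A" and ?b = "osc_b k A"
  note grad = transported_gradient[OF k0 MF]
  have div: "divergence (M t) = (cos (2 * k * t) * divergence A
      - sin (2 * k * t) * vorticity A + sin (2 * k * t) / k * det A) / flow_det k A t"
    and det: "det (M t) = det A / flow_det k A t"
    and vort: "vorticity (M t) = (cos (2 * k * t) * vorticity A
      + sin (2 * k * t) * divergence A + 2 * flow_cos k t * det A) / flow_det k A t" for t
    by (simp_all add: nonzero_eq_divide_eq[OF grad(1)] grad)
  have ct: "continuous_on UNIV (flow_det k A)" "flow_det k A t \<noteq> 0" for t
    using k0 grad(1) by (auto intro: continuous_flow_det)
  show cd: "continuous_on UNIV (\<lambda>t. divergence (M t))"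
    unfolding div using ct k0 by (intro continuous_intros) auto
  have "continuous_on UNIV (\<lambda>t. det (M t))"
    unfolding det using ct by (intro continuous_intros) auto
  then show "continuous_on UNIV (\<lambda>t. spectral_gap_sq (M t))"
    unfolding spectral_gap_sq_def using cd by (intro continuous_intros) auto
  show "stationary_orbit (path_orbit M)" if ab: "?a = 0" "?b = 0"
  proof -
    have d0: "divergence A = 0" and w0: "det A = k * vorticity A"
      using ab k0 by (simp_all add: osc_a_def osc_b_def field_simps)
    have D1: "flow_det k A t = 1" for t
      using ab k0 by (simp add: flow_det_trig)
    have "divergence (M t) = 0" "det (M t) = det A" for t
      using k0 by (simp_all add: div det D1 d0 w0)
    moreover have "vorticity (M t) = vorticity A" for t
      unfolding vort D1 d0 w0 cos_flow[OF k0] by (simp add: algebra_simps)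
    ultimately show ?thesis
      by (simp add: stationary_orbit_def path_orbit_def spectral_gap_sq_def)
  qed
  show "periodic_orbit (path_orbit M) (pi / k)" if ab: "\<not> (?a = 0 \<and> ?b = 0)"
    unfolding periodic_orbit_def
  proof (intro conjI allI impI)
    show "pi / k > 0" using k by simp
    fix t
    have "flow_det k A (t + pi / k) = flow_det k A t"
      by (simp only: flow_det_trig[OF k0] periodic_trig[OF k0])
    moreover have "flow_cos k (t + pi / k) = flow_cos k t"
      by (simp only: flow_cos_def periodic_trig[OF k0])
    ultimately have "divergence (M (t + pi / k)) = divergence (M t)"
      "det (M (t + pi / k)) = det (M t)" "vorticity (M (t + pi / k)) = vorticity (M t)"
      by (simp_all only: div det vort periodic_trig[OF k0])
    then show "path_orbit M (t + pi / k) = path_orbit M t"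
      by (simp add: path_orbit_def spectral_gap_sq_def)
  next
    fix S assume S: "0 < S \<and> S < pi / k"
    show "\<exists>t. path_orbit M (t + S) \<noteq> path_orbit M t"
    proof (rule ccontr)
      assume "\<not> (\<exists>t. path_orbit M (t + S) \<noteq> path_orbit M t)"
      then have per: "divergence (M (t + S)) = divergence (M t)" for t
        by (simp add: path_orbit_def)
      \<comment> \<open>In the variable x = 2 k t the logarithmic derivative of
        \<open>flow_det\<close> is 2 k times the quotient in
        \<open>oscillation_least_period\<close>.\<close>
      have d: "divergence (M (x / (2 * k)))
          = 2 * k * ((?a * cos x + ?b * sin x) / (1 + ?b + ?a * sin x - ?b * cos x))" for x
        using k0 by (simp add: div flow_det_trig) (simp add: osc_a_def osc_b_def field_simps)
      have "?a = 0 \<and> ?b = 0"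
      proof (rule oscillation_least_period)
        show "0 < 1 + ?b + ?a * sin x - ?b * cos x" for x
          using D[of "x / (2 * k)"] k0 by (simp add: flow_det_trig)
        show "0 < 2 * k * S" "2 * k * S < 2 * pi"
          using S k by (simp_all add: field_simps)
        show "(?a * cos (x + 2 * k * S) + ?b * sin (x + 2 * k * S))
            / (1 + ?b + ?a * sin (x + 2 * k * S) - ?b * cos (x + 2 * k * S))
          = (?a * cos x + ?b * sin x) / (1 + ?b + ?a * sin x - ?b * cos x)" for x
        proof -
          have "(x + 2 * k * S) / (2 * k) = x / (2 * k) + S"
            using k0 by (simp add: field_simps)
          then have "divergence (M ((x + 2 * k * S) / (2 * k))) = divergence (M (x / (2 * k)))"
            using per by simp
          then show ?thesis unfolding d mult_cancel_left using k0 by simp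
        qed
      qed
      with ab show False ..
    qed
  qed
qed

theorem theorem1p1:
  fixes k :: real and U0 :: "real^2 \<Rightarrow> real^2"
  assumes "k > 0" and "smooth_on UNIV U0"
  shows
   "((\<exists>\<Omega> U. global_smooth_solution k U0 \<Omega> U) \<longleftrightarrow> (\<forall>\<alpha>. threshold k U0 \<alpha> > 0)) \<and>
    (sublinear_growth U0 \<longrightarrow>
      ((\<exists>U. global_smooth_solution k U0 UNIV U) \<longleftrightarrow> (\<forall>\<alpha>. threshold k U0 \<alpha> > 0))) \<and>
    (\<forall>\<Omega> U. global_smooth_solution k U0 \<Omega> U \<longrightarrow>
      (\<forall>\<alpha> X. particle_path \<Omega> U \<alpha> X \<longrightarrow>
        (\<exists>l1 l2 :: real \<Rightarrow> complex.
          continuous_on UNIV l1 \<and> continuous_on UNIV l2 \<and>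
          (\<forall>t. eigenvalues (jacobian (U t) (at (X t))) = {l1 t, l2 t} \<and>
               complex_of_real (divergence (jacobian (U t) (at (X t)))) = l1 t + l2 t) \<and>
          (let orbit = (\<lambda>t. (vorticity (jacobian (U t) (at (X t))), l1 t, l2 t,
                             divergence (jacobian (U t) (at (X t)))))
           in if p0_denom k U0 \<alpha> \<noteq> 0
              then theta0 k U0 \<alpha> < 1 \<and> periodic_orbit orbit (path_period k U0 \<alpha>)
              else stationary_orbit orbit))))"
proof (intro conjI impI allI)
  show "(\<exists>\<Omega> U. global_smooth_solution k U0 \<Omega> U) \<longleftrightarrow> (\<forall>\<alpha>. threshold k U0 \<alpha> > 0)"
    using global_solution_threshold[OF assms] global_solution_exists[OF assms] by blast
  show "(\<exists>U. global_smooth_solution k U0 UNIV U) \<longleftrightarrow> (\<forall>\<alpha>. threshold k U0 \<alpha> > 0)"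
    if "sublinear_growth U0"
    using global_solution_threshold[OF assms] global_solution_exists_UNIV[OF assms _ that] by blast
next
  fix \<Omega> U \<alpha> X
  assume sol: "global_smooth_solution k U0 \<Omega> U" and X: "particle_path \<Omega> U \<alpha> X"
  define A where "A = jacobian U0 (at \<alpha>)"
  define M where "M t = jacobian (U t) (at (X t))" for t
  define l1 where
    "l1 t = (of_real (divergence (M t)) - real_csqrt (spectral_gap_sq (M t))) / 2" for t
  define l2 where
    "l2 t = (of_real (divergence (M t)) + real_csqrt (spectral_gap_sq (M t))) / 2" for t
  have k0: "k \<noteq> 0" using assms(1) by simp
  have th: "threshold k U0 \<alpha> > 0" by (rule global_solution_threshold[OF assms sol])
  then have D: "flow_det k A t > 0" for t
    using threshold_pos_iff[OF assms(1)] by (simp add: A_def)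
  have MF: "M t *v flow_gradient k A t y
      = cos (2 * k * t) *\<^sub>R (A *v y) + sin (2 * k * t) *\<^sub>R (J *v (A *v y))" for t y
    unfolding M_def A_def by (rule global_solution_gradient[OF k0 assms(2) sol X])
  note orbit = stationary_path_orbit[OF assms(1) D MF] periodic_path_orbit[OF assms(1) D MF]
  have eq: "path_orbit M = (\<lambda>t. (vorticity (M t), l1 t, l2 t, divergence (M t)))"
    by (simp add: fun_eq_iff path_orbit_def l1_def l2_def)
  have "continuous_on UNIV l1" "continuous_on UNIV l2"
    unfolding l1_def l2_def
    using continuous_divergence[OF assms(1) D MF] continuous_spectral_gap_sq[OF assms(1) D MF]
    by (intro continuous_intros; simp)+
  moreover have "eigenvalues (M t) = {l1 t, l2 t}" for t
    unfolding l1_def l2_def by (rule eigenvalues_eq[OF real_csqrt_square])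
  moreover have "complex_of_real (divergence (M t)) = l1 t + l2 t" for t
    by (simp add: l1_def l2_def add_divide_distrib[symmetric])
  \<comment> \<open>\<open>p0_denom_eq_0_iff\<close> turns the case distinction into a = b = 0, and
    \<open>path_period_eq\<close> replaces the integral by pi / k.\<close>
  moreover have "if p0_denom k U0 \<alpha> \<noteq> 0
      then theta0 k U0 \<alpha> < 1 \<and> periodic_orbit (path_orbit M) (path_period k U0 \<alpha>)
      else stationary_orbit (path_orbit M)"
    using orbit theta0_bounds(2)[OF assms(1) th] path_period_eq[OF assms(1) th]
      p0_denom_eq_0_iff[OF assms(1) th] by (auto simp: A_def)
  ultimately show "\<exists>l1 l2 :: real \<Rightarrow> complex.
      continuous_on UNIV l1 \<and> continuous_on UNIV l2 \<and>
      (\<forall>t. eigenvalues (jacobian (U t) (at (X t))) = {l1 t, l2 t} \<and>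
           complex_of_real (divergence (jacobian (U t) (at (X t)))) = l1 t + l2 t) \<and>
      (let orbit = (\<lambda>t. (vorticity (jacobian (U t) (at (X t))), l1 t, l2 t,
                         divergence (jacobian (U t) (at (X t)))))
       in if p0_denom k U0 \<alpha> \<noteq> 0
          then theta0 k U0 \<alpha> < 1 \<and> periodic_orbit orbit (path_period k U0 \<alpha>)
          else stationary_orbit orbit)"
    unfolding Let_def M_def[symmetric] eq by blast
qed

end
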